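(* In the variable-assignment setting, suppose that $\Pr_\Omega(B)\le p$ and $|N(B)|\le d$ for all $B\in\mathcal B$, where $e\,p\,d\le1$. Let $i\in\{1,\dots,n\}$, let $D$ be a set of possible values of the variable $X(i)$, and let $A$ be the event $X(i)\in D$ (so $\mathrm{var}(A)=\{i\}$). Let $\mathcal B'$ be the set of bad-events $B\in\mathcal B[A]$ with $i\in\mathrm{var}(B)$, and let $\vee\mathcal B'=\bigcup_{B\in\mathcal B'}B$. Then $$\Pr_{\mathrm{MT}}(A)\ \le\ \Pr_\Omega(A)\bigl(1+e^{e p d}\,\Pr_\Omega(\vee\mathcal B')\bigr).$$
   Context: Variable-assignment setting: $\Omega$ is a product probability space with independent random variables $X(1),\dots,X(n)$. Every event $E$ considered is a boolean function of the variables in a specified subset $\mathrm{var}(E)\subseteq\{1,\dots,n\}$, and $E\sim E'$ means $\mathrm{var}(E)\cap\mathrm{var}(E')\ne\emptyset$. $\mathcal B$ is a finite collection of events (the bad-events). For an event $E$, $N(E)=\{B\in\mathcal B: B\sim E\}$ (for $B\in\mathcal B$ this is the inclusive neighborhood, so $B\in N(B)$). For an event $E$, $\mathcal B[E]$ is the set of $B\in\mathcal B$ with $\Pr_\Omega(E\mid B)<1$ (i.e. $\Pr_\Omega(B\cap\overline E)>0$). MT (Moser–Tardos) algorithm: draw $X\sim\Omega$; while some $B\in\mathcal B$ is true on $X$, choose some true $B\in\mathcal B$ (by an arbitrary fixed, possibly randomized, rule) and resample all variables in $\mathrm{var}(B)$ independently from their distributions in $\Omega$. Under the stated hypotheses (the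 symmetric Lovász Local Lemma criterion) it terminates with probability one. $\Pr_{\mathrm{MT}}$ denotes probability with respect to the distribution of $X$ at termination; the result holds for every choice of selection rule. Here $e$ is the base of the natural logarithm. *)

theory Defs
  imports "HOL-Probability.Probability"
begin

text \<open>
  The variable-assignment setting. The values of the variable \<open>X(j)\<close>, \<open>1 \<le> j \<le> n\<close>, are
  distributed according to the probability space \<open>M j\<close>; the outcomes of \<open>\<Omega>\<close> are the full
  assignments.
\<close>

definition Omega :: "nat \<Rightarrow> (nat \<Rightarrow> 'a measure) \<Rightarrow> (nat \<Rightarrow> 'a) measure" where
  "Omega n M = PiM {1..n} M"

text \<open>
  The set of variables of an event is specified data: it contains the variables the event
  depends on, but it need not be the least such set.
\<close>

datatype 'a event = Event (vars: "nat set") (outcomes: "(nat \<Rightarrow> 'a) set")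

definition is_event :: "nat \<Rightarrow> (nat \<Rightarrow> 'a measure) \<Rightarrow> 'a event \<Rightarrow> bool" where
  "is_event n M E \<longleftrightarrow>
     vars E \<subseteq> {1..n} \<and> outcomes E \<in> sets (Omega n M) \<and>
     (\<forall>x\<in>space (Omega n M). \<forall>y\<in>space (Omega n M).
        (\<forall>j\<in>vars E. x j = y j) \<longrightarrow> (x \<in> outcomes E \<longleftrightarrow> y \<in> outcomes E))"

definition related :: "'a event \<Rightarrow> 'a event \<Rightarrow> bool" where
  "related E E' \<longleftrightarrow> vars E \<inter> vars E' \<noteq> {}"

definition nbhd :: "'a event set \<Rightarrow> 'a event \<Rightarrow> 'a event set" where
  "nbhd \<B> E = {B \<in> \<B>. related B E}"

text \<open>
  The last condition says that \<open>nbhd \<B> B\<close> is the inclusive neighbourhood of a bad-event \<open>B\<close>;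
  it amounts to \<open>vars B \<noteq> {}\<close>.
\<close>

definition variable_setting :: "nat \<Rightarrow> (nat \<Rightarrow> 'a measure) \<Rightarrow> 'a event set \<Rightarrow> bool" where
  "variable_setting n M \<B> \<longleftrightarrow>
     (\<forall>j\<in>{1..n}. prob_space (M j)) \<and> finite \<B> \<and>
     (\<forall>B\<in>\<B>. is_event n M B) \<and> (\<forall>B\<in>\<B>. B \<in> nbhd \<B> B)"

text \<open>The set \<open>\<B>[E]\<close> of bad-events \<open>B\<close> with \<open>Pr(E | B) < 1\<close>, i.e. \<open>Pr(B \<inter> - E) > 0\<close>.\<close>

definition bad_not_implying ::
  "nat \<Rightarrow> (nat \<Rightarrow> 'a measure) \<Rightarrow> 'a event set \<Rightarrow> 'a event \<Rightarrow> 'a event set" where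
  "bad_not_implying n M \<B> E =
     {B \<in> \<B>. measure (Omega n M) (outcomes B - outcomes E) > 0}"

definition value_event :: "nat \<Rightarrow> (nat \<Rightarrow> 'a measure) \<Rightarrow> nat \<Rightarrow> 'a set \<Rightarrow> 'a event" where
  "value_event n M i D = Event {i} {x \<in> space (Omega n M). x i \<in> D}"

text \<open>
  A selection rule sees, at time \<open>t\<close>, the states \<open>h 0, \<dots>, h t\<close> reached so far and a random seed
  drawn from an arbitrary probability space \<open>U\<close> (independently of all samples of the variables),
  and returns a bad-event that is true on the current state \<open>h t\<close> whenever there is one. Its
  value is irrelevant otherwise. The earlier selections are functions of the same data.
\<close>

type_synonym ('u, 'a) rule = "nat \<Rightarrow> 'u \<Rightarrow> (nat \<Rightarrow> nat \<Rightarrow> 'a) \<Rightarrow> 'a event"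

definition selection_rule ::
  "nat \<Rightarrow> (nat \<Rightarrow> 'a measure) \<Rightarrow> 'a event set \<Rightarrow> 'u measure \<Rightarrow> ('u, 'a) rule \<Rightarrow> bool" where
  "selection_rule n M \<B> U \<sigma> \<longleftrightarrow>
     prob_space U \<and>
     (\<forall>t. (\<lambda>(u, h). \<sigma> t u h)
            \<in> measurable (U \<Otimes>\<^sub>M PiM {..t} (\<lambda>_. Omega n M)) (count_space UNIV)) \<and>
     (\<forall>t. \<forall>u\<in>space U. \<forall>h\<in>space (PiM {..t} (\<lambda>_. Omega n M)).
        (\<exists>B\<in>\<B>. h t \<in> outcomes B) \<longrightarrow> \<sigma> t u h \<in> \<B> \<and> h t \<in> outcomes (\<sigma> t u h))"

definition resample :: "nat set \<Rightarrow> (nat \<Rightarrow> 'a) \<Rightarrow> (nat \<Rightarrow> 'a) \<Rightarrow> nat \<Rightarrow> 'a" where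
  "resample V x y = (\<lambda>j. if j \<in> V then y j else x j)"

text \<open>
  \<open>mt_history \<B> \<sigma> u y t\<close> is the sequence of the states at times \<open>0, \<dots>, t\<close> of the Moser-Tardos
  algorithm run with seed \<open>u\<close>, initial sample \<open>y 0\<close>, and fresh sample \<open>y (Suc t)\<close> for the
  resampling step after time \<open>t\<close> (of which only the coordinates in the resampled set are used).
  Once no bad-event is true, the state stays constant.
\<close>

primrec mt_history ::
  "'a event set \<Rightarrow> ('u, 'a) rule \<Rightarrow> 'u \<Rightarrow> (nat \<Rightarrow> nat \<Rightarrow> 'a) \<Rightarrow> nat \<Rightarrow> nat \<Rightarrow> nat \<Rightarrow> 'a" where
  "mt_history \<B> \<sigma> u y 0 = (\<lambda>s\<in>{..0}. y 0)"
| "mt_history \<B> \<sigma> u y (Suc t) =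
     (let h = mt_history \<B> \<sigma> u y t
      in h(Suc t :=
           if \<exists>B\<in>\<B>. h t \<in> outcomes B then resample (vars (\<sigma> t u h)) (h t) (y (Suc t))
           else h t))"

definition mt_state ::
  "'a event set \<Rightarrow> ('u, 'a) rule \<Rightarrow> 'u \<Rightarrow> (nat \<Rightarrow> nat \<Rightarrow> 'a) \<Rightarrow> nat \<Rightarrow> nat \<Rightarrow> 'a" where
  "mt_state \<B> \<sigma> u y t = mt_history \<B> \<sigma> u y t t"

definition mt_terminated ::
  "'a event set \<Rightarrow> ('u, 'a) rule \<Rightarrow> 'u \<Rightarrow> (nat \<Rightarrow> nat \<Rightarrow> 'a) \<Rightarrow> nat \<Rightarrow> bool" where
  "mt_terminated \<B> \<sigma> u y t \<longleftrightarrow> (\<forall>B\<in>\<B>. mt_state \<B> \<sigma> u y t \<notin> outcomes B)"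

definition mt_space ::
  "nat \<Rightarrow> (nat \<Rightarrow> 'a measure) \<Rightarrow> 'u measure \<Rightarrow> ('u \<times> (nat \<Rightarrow> nat \<Rightarrow> 'a)) measure" where
  "mt_space n M U = U \<Otimes>\<^sub>M PiM (UNIV :: nat set) (\<lambda>_. Omega n M)"

text \<open>
  The probability that the algorithm terminates with a final state satisfying \<open>E\<close>.
\<close>

definition mt_prob ::
  "nat \<Rightarrow> (nat \<Rightarrow> 'a measure) \<Rightarrow> 'a event set \<Rightarrow> 'u measure \<Rightarrow> ('u, 'a) rule \<Rightarrow> 'a event \<Rightarrow> real" where
  "mt_prob n M \<B> U \<sigma> E =
     measure (mt_space n M U)
       {(u, y) \<in> space (mt_space n M U).
          (\<exists>t. mt_terminated \<B> \<sigma> u y t) \<and>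
          mt_state \<B> \<sigma> u y (LEAST t. mt_terminated \<B> \<sigma> u y t) \<in> outcomes E}"

end

theory Submission
  imports Defs
begin

text \<open>
  If \<open>A\<close> holds at termination, then either it holds initially, or some resampling of a bad-event
  \<open>B \<in> \<B>'\<close> makes \<open>A\<close> true for the first time. Run the algorithm on a resampling table, and
  explain the truth of \<open>B\<close> at that moment by layers of resampled events: the first layer is a set
  of variable-disjoint neighbours of \<open>B\<close>, and each further layer is such a set of neighbours of
  the layer before. For fixed layers, the events that all their resamplings were justified,
  that \<open>B\<close> is true after them, and that the next value of \<open>X(i)\<close> lies in \<open>D\<close> depend on disjoint
  parts of the table. Summed over all layers, the probabilities of the layers give at most
  \<open>e\<^bsup>epd\<^esup>\<close>.

  To obtain \<open>Pr(\<or>\<B>')\<close> in place of a sum over \<open>B \<in> \<B>'\<close>, enumerate \<open>\<B>'\<close> and take the least \<open>k\<close> such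
  that \<open>B\<^sub>k\<close> has a justified explanation anywhere in the table, whether or not the algorithm
  performs it. If an earlier \<open>B\<^sub>j\<close> were true on the assignment reached by the layers of \<open>B\<^sub>k\<close>,
  then the part of these layers below \<open>B\<^sub>j\<close> would be an explanation of \<open>B\<^sub>j\<close>, with the same next
  value of \<open>X(i)\<close>. Hence \<open>B\<^sub>k\<close> is the first true event of \<open>\<B>'\<close> on this assignment, and these events
  are disjoint.
\<close>

section \<open>Resampling tables\<close>

text \<open>The tuple of all coordinates is the identity of the product space, so its law is the
  product of the marginal laws.\<close>

lemma indep_vars_PiM_coordinates:
  assumes "I \<noteq> {}" and prob: "\<And>i. i \<in> I \<Longrightarrow> prob_space (M i)"
  shows "prob_space.indep_vars (PiM I M) M (\<lambda>i \<omega>. \<omega> i) I"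
proof -
  interpret prob_space "PiM I M" by (intro prob_space_PiM prob)
  have "distr (PiM I M) (PiM I M) (\<lambda>\<omega>. \<lambda>i\<in>I. \<omega> i) = PiM I M"
    using distr_PiM_reindex[of I M "\<lambda>i. i" I] prob by auto
  also have "\<dots> = (\<Pi>\<^sub>M i\<in>I. distr (PiM I M) (M i) (\<lambda>\<omega>. \<omega> i))"
    by (intro PiM_cong refl distr_PiM_component[symmetric] prob)
  finally show ?thesis
    by (subst indep_vars_iff_distr_eq_PiM'[OF \<open>I \<noteq> {}\<close>]) auto
qed

text \<open>The rows are disjoint blocks of independent cells, hence independent. This identifies a
  table of cells with a sequence of assignments, so that single cells can be relabelled.\<close>

lemma distr_PiM_curry:
  assumes "I \<noteq> {}" "J \<noteq> {}" and prob: "\<And>j. j \<in> J \<Longrightarrow> prob_space (M j)"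
  shows "distr (PiM (I \<times> J) (\<lambda>(c, j). M j)) (PiM I (\<lambda>_. PiM J M)) (\<lambda>\<omega>. \<lambda>c\<in>I. \<lambda>j\<in>J. \<omega> (c, j))
         = PiM I (\<lambda>_. PiM J M)"
proof -
  let ?M = "\<lambda>(c, j). M j" and ?P = "PiM (I \<times> J) (\<lambda>(c, j). M j)"
  have prob': "prob_space (?M k)" if "k \<in> I \<times> J" for k using that prob by auto
  interpret prob_space ?P by (intro prob_space_PiM prob')
  have "indep_vars ?M (\<lambda>k \<omega>. \<omega> k) (I \<times> J)"
    using assms by (intro indep_vars_PiM_coordinates prob') auto
  then have "indep_vars (\<lambda>c. PiM ({c} \<times> J) ?M) (\<lambda>c \<omega>. restrict (\<lambda>k. \<omega> k) ({c} \<times> J)) I"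
    by (rule indep_vars_restrict) (auto simp: disjoint_family_on_def)
  then have "indep_vars (\<lambda>_. PiM J M) (\<lambda>c. (\<lambda>\<omega>. \<lambda>j\<in>J. \<omega> (c, j)) \<circ> (\<lambda>\<omega>. restrict (\<lambda>k. \<omega> k) ({c} \<times> J))) I"
  proof (rule indep_vars_compose)
    fix c assume "c \<in> I"
    show "(\<lambda>\<omega>. \<lambda>j\<in>J. \<omega> (c, j)) \<in> PiM ({c} \<times> J) ?M \<rightarrow>\<^sub>M PiM J M"
      by (rule measurable_restrict) (use measurable_component_singleton[of "(c, _)" "{c} \<times> J" ?M] in auto)
  qed
  also have "?this \<longleftrightarrow> indep_vars (\<lambda>_. PiM J M) (\<lambda>c \<omega>. \<lambda>j\<in>J. \<omega> (c, j)) I"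
    by (intro indep_vars_cong) (auto simp: fun_eq_iff)
  finally have ind: "indep_vars (\<lambda>_. PiM J M) (\<lambda>c \<omega>. \<lambda>j\<in>J. \<omega> (c, j)) I" .
  have meas: "(\<lambda>\<omega>. \<lambda>j\<in>J. \<omega> (c, j)) \<in> ?P \<rightarrow>\<^sub>M PiM J M" if "c \<in> I" for c
    by (rule measurable_restrict) (use that measurable_component_singleton[of "(c, _)" "I \<times> J" ?M] in auto)
  have "distr ?P (PiM J M) (\<lambda>\<omega>. \<lambda>j\<in>J. \<omega> (c, j)) = PiM J M" if "c \<in> I" for c
    using distr_PiM_reindex[of "I \<times> J" ?M "\<lambda>j. (c, j)" J] prob' that by (auto simp: inj_on_def)
  with ind show ?thesis
    by (subst (asm) indep_vars_iff_distr_eq_PiM'[OF \<open>I \<noteq> {}\<close> meas]) (auto cong: PiM_cong)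
qed

text \<open>
  In a table \<open>R\<close>, the entry \<open>R c j\<close> is the \<open>c\<close>-th sample of variable \<open>j\<close>, so that \<open>R 0\<close> is the
  current assignment; resampling \<open>V\<close> moves the columns in \<open>V\<close> up by one.
\<close>

definition advance :: "nat set \<Rightarrow> (nat \<Rightarrow> nat \<Rightarrow> 'a) \<Rightarrow> nat \<Rightarrow> nat \<Rightarrow> 'a" where
  "advance V R c = resample V (R c) (R (Suc c))"

lemma advance_apply: "advance V R c j = (if j \<in> V then R (Suc c) j else R c j)"
  by (simp add: advance_def resample_def)

lemma advance_empty [simp]: "advance {} R = R"
  by (simp add: fun_eq_iff advance_apply)

lemma advance_commute: "advance V (advance W R) = advance W (advance V R)"
  by (simp add: fun_eq_iff advance_apply)

lemma advance_Un: "V \<inter> W = {} \<Longrightarrow> advance V (advance W R) = advance (V \<union> W) R"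
  by (auto simp: fun_eq_iff advance_apply)

lemma advance_case_nat:
  "advance V (case_nat x R) = case_nat (resample V x (R 0)) (advance V R)"
  by (auto simp: fun_eq_iff advance_def split: nat.split)

section \<open>The law of a table and its behaviour under resampling\<close>

locale independent_variables =
  fixes n :: nat and M :: "nat \<Rightarrow> 'a measure"
  assumes prob: "\<And>j. j \<in> {1..n} \<Longrightarrow> prob_space (M j)"
begin

abbreviation "\<Omega> \<equiv> Omega n M"

lemma prob_space_Omega: "prob_space \<Omega>"
  unfolding Omega_def by (intro prob_space_PiM prob)

sublocale sequence_space \<Omega>
  by (intro sequence_space.intro product_prob_spaceI prob_space_Omega)

lemma space_Omega: "space \<Omega> = (\<Pi>\<^sub>E j\<in>{1..n}. space (M j))"
  by (simp add: Omega_def space_PiM)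

lemma space_S: "R \<in> space S \<longleftrightarrow> (\<forall>c. R c \<in> space \<Omega>)"
  by (auto simp: space_PiM PiE_iff)

lemma resample_in_space:
  "x \<in> space \<Omega> \<Longrightarrow> y \<in> space \<Omega> \<Longrightarrow> resample V x y \<in> space \<Omega>"
  by (auto simp: space_Omega resample_def PiE_iff extensional_def)

lemma advance_in_space: "R \<in> space S \<Longrightarrow> advance V R \<in> space S"
  by (auto simp: space_S advance_def intro: resample_in_space)

lemma measurable_resample [measurable]:
  assumes [measurable]: "f \<in> N \<rightarrow>\<^sub>M \<Omega>" "g \<in> N \<rightarrow>\<^sub>M \<Omega>"
  shows "(\<lambda>x. resample V (f x) (g x)) \<in> N \<rightarrow>\<^sub>M \<Omega>"
  unfolding Omega_def
proof (rule measurable_PiM_single')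
  have comp: "(\<lambda>x. f x j) \<in> N \<rightarrow>\<^sub>M M j" "(\<lambda>x. g x j) \<in> N \<rightarrow>\<^sub>M M j" if "j \<in> {1..n}" for j
    using assms that by (auto simp: Omega_def intro: measurable_component_singleton[THEN measurable_compose[rotated]])
  show "(\<lambda>x. resample V (f x) (g x) j) \<in> N \<rightarrow>\<^sub>M M j" if "j \<in> {1..n}" for j
    using comp[OF that] by (cases "j \<in> V") (simp_all add: resample_def)
  show "(\<lambda>x. resample V (f x) (g x)) \<in> space N \<rightarrow> (\<Pi>\<^sub>E j\<in>{1..n}. space (M j))"
    using assms[THEN measurable_space] resample_in_space by (auto simp: space_Omega Pi_iff)
qed

lemma measurable_advance [measurable]:
  assumes [measurable]: "f \<in> N \<rightarrow>\<^sub>M S"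
  shows "(\<lambda>x. advance V (f x)) \<in> N \<rightarrow>\<^sub>M S"
  by (rule measurable_PiM_single') (use measurable_space[OF assms] in \<open>auto simp: advance_def space_S intro!: resample_in_space\<close>)

text \<open>Advancing relabels the cells by an injection that keeps each cell in its column, and the
  law of a cell depends on its column only.\<close>

lemma distr_advance: "distr S S (advance V) = S"
proof (cases "n = 0")
  case True
  \<comment> \<open>Currying needs a nonempty set of variables. Without variables there is only one
    assignment, so all rows coincide.\<close>
  have "advance V R = R" if "R \<in> space S" for R
  proof -
    have "R c \<in> (\<Pi>\<^sub>E j\<in>{1..n}. space (M j))" for c
      using that by (simp only: space_S space_Omega)
    with True show ?thesis by (simp add: fun_eq_iff advance_apply)
  qed
  then show ?thesis
    by (subst distr_cong[OF refl refl, where g = "\<lambda>R. R"]) (auto simp: distr_id)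
next
  case False
  let ?M = "\<lambda>(c::nat, j). M j" and ?I = "(UNIV :: nat set) \<times> {1..n}"
  let ?P = "PiM ?I ?M"
  \<comment> \<open>\<open>f\<close> sends a cell to the cell from which the advanced table takes
    its entry.\<close>
  define f where "f = (\<lambda>(c, j). (if j \<in> V then Suc c else c, j))"
  define cur :: "(nat \<times> nat \<Rightarrow> 'a) \<Rightarrow> nat \<Rightarrow> nat \<Rightarrow> 'a" where "cur = (\<lambda>\<omega>. \<lambda>c\<in>UNIV. \<lambda>j\<in>{1..n}. \<omega> (c, j))"
  define re :: "(nat \<times> nat \<Rightarrow> 'a) \<Rightarrow> nat \<times> nat \<Rightarrow> 'a" where "re = (\<lambda>\<omega>. \<lambda>k\<in>?I. \<omega> (f k))"
  have prob': "prob_space (?M k)" if "k \<in> ?I" for k using that prob by auto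
  have Mf: "(\<lambda>k. ?M (f k)) = ?M" by (auto simp: f_def fun_eq_iff)
  have f: "inj_on f ?I" "f \<in> ?I \<rightarrow> ?I"
    by (auto simp: inj_on_def f_def split: if_splits)
  have re: "distr ?P ?P re = ?P"
    using distr_PiM_reindex[of ?I ?M f ?I, OF prob' f] by (simp add: Mf re_def)
  have cur: "distr ?P S cur = S"
    using distr_PiM_curry[of UNIV "{1..n}" M] prob False by (simp add: Omega_def cur_def)
  have cur_meas: "cur \<in> ?P \<rightarrow>\<^sub>M S" unfolding cur_def Omega_def
    by (intro measurable_restrict) (use measurable_component_singleton[of "(_, _)" "?I" ?M] in auto)
  have re_meas: "re \<in> ?P \<rightarrow>\<^sub>M ?P" unfolding re_def
  proof (rule measurable_restrict)
    fix k assume "k \<in> ?I"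
    with f(2) have "f k \<in> ?I" by auto
    then have "(\<lambda>\<omega>. \<omega> (f k)) \<in> ?P \<rightarrow>\<^sub>M ?M (f k)" by (rule measurable_component_singleton)
    also have "?M (f k) = ?M k" using Mf by (rule fun_cong)
    finally show "(\<lambda>\<omega>. \<omega> (f k)) \<in> ?P \<rightarrow>\<^sub>M ?M k" .
  qed
  have comp: "advance V \<circ> cur = cur \<circ> re"
    by (auto simp: fun_eq_iff advance_apply cur_def re_def f_def)
  have "distr S S (advance V) = distr (distr ?P S cur) S (advance V)" by (simp only: cur)
  also have "\<dots> = distr ?P S (advance V \<circ> cur)"
    by (rule distr_distr[OF _ cur_meas]) measurable
  also have "\<dots> = distr ?P S (cur \<circ> re)" by (simp only: comp)
  also have "\<dots> = distr (distr ?P ?P re) S cur" by (rule distr_distr[OF cur_meas re_meas, symmetric])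
  also have "\<dots> = S" by (simp only: re cur)
  finally show ?thesis .
qed

lemma measurable_case_nat_S [measurable]:
  assumes "f \<in> N \<rightarrow>\<^sub>M \<Omega>" "g \<in> N \<rightarrow>\<^sub>M S"
  shows "(\<lambda>x. case_nat (f x) (g x)) \<in> N \<rightarrow>\<^sub>M S"
  using assms by (rule measurable_case_nat')

lemma measurable_tail: "(\<lambda>R c. R (Suc c)) \<in> S \<rightarrow>\<^sub>M S"
  by (rule measurable_PiM_single') (auto simp: space_S)

text \<open>Row 0 is independent of the remaining rows, and these are again distributed like a
  table.\<close>

lemma nn_integral_S_split:
  assumes [measurable]: "f \<in> borel_measurable S"
  shows "(\<integral>\<^sup>+R. f R \<partial>S) = (\<integral>\<^sup>+x. \<integral>\<^sup>+R. f (case_nat x R) \<partial>S \<partial>\<Omega>)"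
proof -
  have "(\<integral>\<^sup>+R. f R \<partial>S) = (\<integral>\<^sup>+R. f R \<partial>distr (\<Omega> \<Otimes>\<^sub>M S) S (\<lambda>(s, \<omega>). case_nat s \<omega>))"
    by (simp add: PiM_iter)
  also have "\<dots> = (\<integral>\<^sup>+(x, R). f (case_nat x R) \<partial>(\<Omega> \<Otimes>\<^sub>M S))"
    by (subst nn_integral_distr) (auto simp: split_beta')
  also have "\<dots> = (\<integral>\<^sup>+x. \<integral>\<^sup>+R. f (case_nat x R) \<partial>S \<partial>\<Omega>)"
    by (subst P.nn_integral_fst[symmetric]) auto
  finally show ?thesis .
qed

text \<open>
  The entries read by resampling \<open>V\<close> are independent of the advanceed table, because the
  sample at level \<open>0\<close> outside \<open>V\<close> may be replaced by an independent copy.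
\<close>

lemma nn_integral_advance:
  assumes meas_g: "(\<lambda>(x, R). g x R) \<in> borel_measurable (\<Omega> \<Otimes>\<^sub>M S)"
    and g: "\<And>x y R. x \<in> space \<Omega> \<Longrightarrow> y \<in> space \<Omega> \<Longrightarrow> R \<in> space S \<Longrightarrow> (\<forall>j\<in>V. x j = y j) \<Longrightarrow> g x R = g y R"
  shows "(\<integral>\<^sup>+R. g (R 0) (advance V R) \<partial>S) = (\<integral>\<^sup>+x. \<integral>\<^sup>+R. g x R \<partial>S \<partial>\<Omega>)"
proof -
  have meas: "(\<lambda>x. g (f x) (h x)) \<in> borel_measurable N"
    if "f \<in> N \<rightarrow>\<^sub>M \<Omega>" "h \<in> N \<rightarrow>\<^sub>M S" for f h and N :: "(nat \<Rightarrow> nat \<Rightarrow> 'a) measure"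
    using measurable_compose[OF measurable_Pair[OF that] meas_g] by (simp only: prod.case)
  have m0: "(\<lambda>R. g (R 0) (\<lambda>c. R (Suc c))) \<in> borel_measurable S"
    by (intro meas measurable_tail) simp
  have m1: "(\<lambda>R. g (advance V R 0) (\<lambda>c. advance V R (Suc c))) \<in> borel_measurable S"
    using measurable_compose[OF _ m0, of "advance V" S] by simp
  have "(\<integral>\<^sup>+x. \<integral>\<^sup>+R. g x R \<partial>S \<partial>\<Omega>) = (\<integral>\<^sup>+R. g (R 0) (\<lambda>c. R (Suc c)) \<partial>S)"
    by (subst nn_integral_S_split[OF m0]) simp
  also have "\<dots> = (\<integral>\<^sup>+R. g (R 0) (\<lambda>c. R (Suc c)) \<partial>distr S S (advance V))"
    by (simp add: distr_advance)
  also have "\<dots> = (\<integral>\<^sup>+R. g (advance V R 0) (\<lambda>c. advance V R (Suc c)) \<partial>S)"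
    by (rule nn_integral_distr) (simp_all add: m0)
  \<comment> \<open>For the table \<open>case_nat x R\<close>, the advanced row 0 takes its entries
    in \<open>V\<close> from \<open>R 0\<close>; so \<open>x\<close> enters only outside
    \<open>V\<close>, where \<open>g\<close> ignores it.\<close>
  also have "\<dots> = (\<integral>\<^sup>+x. \<integral>\<^sup>+R. g (resample V x (R 0)) (advance V R) \<partial>S \<partial>\<Omega>)"
    by (subst nn_integral_S_split) (simp_all add: advance_case_nat m1)
  also have "\<dots> = (\<integral>\<^sup>+x. \<integral>\<^sup>+R. g (R 0) (advance V R) \<partial>S \<partial>\<Omega>)"
    by (intro nn_integral_cong g resample_in_space advance_in_space) (auto simp: space_S resample_def)
  also have "\<dots> = (\<integral>\<^sup>+R. g (R 0) (advance V R) \<partial>S)"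
    by (simp add: M.emeasure_space_1)
  finally show ?thesis ..
qed

end

section \<open>Words and layers of resamplings\<close>

text \<open>
  A word lists resamplings in chronological order, whereas the head of a list of layers is
  resampled last.
\<close>

fun word_table :: "'a event list \<Rightarrow> (nat \<Rightarrow> nat \<Rightarrow> 'a) \<Rightarrow> nat \<Rightarrow> nat \<Rightarrow> 'a" where
  "word_table [] R = R"
| "word_table (B # w) R = word_table w (advance (vars B) R)"

fun word_consistent :: "'a event list \<Rightarrow> (nat \<Rightarrow> nat \<Rightarrow> 'a) \<Rightarrow> bool" where
  "word_consistent [] R \<longleftrightarrow> True"
| "word_consistent (B # w) R \<longleftrightarrow> R 0 \<in> outcomes B \<and> word_consistent w (advance (vars B) R)"

fun layers_table :: "'a event set list \<Rightarrow> (nat \<Rightarrow> nat \<Rightarrow> 'a) \<Rightarrow> nat \<Rightarrow> nat \<Rightarrow> 'a" where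
  "layers_table [] R = R"
| "layers_table (I # L) R = advance (\<Union>B\<in>I. vars B) (layers_table L R)"

fun layers_consistent :: "'a event set list \<Rightarrow> (nat \<Rightarrow> nat \<Rightarrow> 'a) \<Rightarrow> bool" where
  "layers_consistent [] R \<longleftrightarrow> True"
| "layers_consistent (I # L) R \<longleftrightarrow>
     layers_consistent L R \<and> (\<forall>B\<in>I. layers_table L R 0 \<in> outcomes B)"

definition stable :: "'a event set \<Rightarrow> bool" where
  "stable I \<longleftrightarrow> pairwise (\<lambda>B C. vars B \<inter> vars C = {}) I"

text \<open>These are stable set sequences; \<open>P\<close> is the layer above the first one.
  Layers are nonempty so that, when weights are summed, the list \<open>[]\<close> alone stands for
  an empty next layer.\<close>

fun stable_layers :: "'a event set \<Rightarrow> 'a event set \<Rightarrow> 'a event set list \<Rightarrow> bool" where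
  "stable_layers \<B> P [] \<longleftrightarrow> True"
| "stable_layers \<B> P (I # L) \<longleftrightarrow>
     I \<subseteq> \<B> \<and> I \<noteq> {} \<and> stable I \<and> (\<forall>B\<in>I. \<exists>C\<in>P. related B C) \<and> stable_layers \<B> I L"

lemma stable_layers_mono: "stable_layers \<B> P L \<Longrightarrow> P \<subseteq> Q \<Longrightarrow> stable_layers \<B> Q L"
  by (cases L) (simp_all, blast)

lemma stable_layers_subset: "stable_layers \<B> P L \<Longrightarrow> I \<in> set L \<Longrightarrow> I \<subseteq> \<B> \<and> stable I"
  by (induction L arbitrary: P) auto

lemma word_table_append: "word_table (v @ w) R = word_table w (word_table v R)"
  by (induction v arbitrary: R) auto

lemma word_consistent_append:
  "word_consistent (v @ w) R \<longleftrightarrow> word_consistent v R \<and> word_consistent w (word_table v R)"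
  by (induction v arbitrary: R) auto

lemma layers_table_advance: "layers_table L (advance V R) = advance V (layers_table L R)"
  by (induction L) (simp_all add: advance_commute)

lemma layers_table_eq:
  "(\<And>I B. I \<in> set L \<Longrightarrow> B \<in> I \<Longrightarrow> j \<notin> vars B) \<Longrightarrow> layers_table L R c j = R c j"
  by (induction L) (auto simp: advance_apply)

section \<open>Rearranging words into layers and back\<close>

locale bad_events = independent_variables n M for n and M :: "nat \<Rightarrow> 'a measure" +
  fixes \<B> :: "'a event set"
  assumes finite_bad: "finite \<B>"
    and is_event: "\<And>B. B \<in> \<B> \<Longrightarrow> is_event n M B"
begin

lemma outcomes_cong:
  assumes "B \<in> \<B>" "x \<in> space \<Omega>" "y \<in> space \<Omega>" "\<And>j. j \<in> vars B \<Longrightarrow> x j = y j"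
  shows "x \<in> outcomes B \<longleftrightarrow> y \<in> outcomes B"
  using is_event[OF assms(1)] assms(2-4) unfolding is_event_def by blast

lemma outcomes_sets: "B \<in> \<B> \<Longrightarrow> outcomes B \<in> sets \<Omega>"
  using is_event by (auto simp: is_event_def)

lemma layers_table_in_space: "R \<in> space S \<Longrightarrow> layers_table L R \<in> space S"
  by (induction L) (simp_all add: advance_in_space)

lemma word_table_in_space: "R \<in> space S \<Longrightarrow> word_table w R \<in> space S"
  by (induction w arbitrary: R) (simp_all add: advance_in_space)

lemma advance_outcomes:
  assumes "R \<in> space S" "B \<in> \<B>" "V \<inter> vars B = {}"
  shows "advance V R 0 \<in> outcomes B \<longleftrightarrow> R 0 \<in> outcomes B"
proof (rule outcomes_cong[OF assms(2)])
  show "advance V R 0 \<in> space \<Omega>" "R 0 \<in> space \<Omega>"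
    using assms(1) advance_in_space[OF assms(1), of V] unfolding space_S by blast+
  show "advance V R 0 j = R 0 j" if "j \<in> vars B" for j
    using assms(3) that by (auto simp: advance_apply)
qed

lemma layers_consistent_advance:
  assumes "R \<in> space S" "\<And>I B. I \<in> set L \<Longrightarrow> B \<in> I \<Longrightarrow> B \<in> \<B> \<and> V \<inter> vars B = {}"
  shows "layers_consistent L (advance V R) \<longleftrightarrow> layers_consistent L R"
  using assms(2)
proof (induction L)
  case (Cons I L)
  have "(layers_table L (advance V R) 0 \<in> outcomes B) \<longleftrightarrow> (layers_table L R 0 \<in> outcomes B)" if "B \<in> I" for B
    using Cons.prems[of I B] that assms(1)
    by (simp add: layers_table_advance advance_outcomes layers_table_in_space)
  with Cons show ?case by (metis layers_consistent.simps(2) list.set_intros)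
qed simp

text \<open>
  A resampling that happens before all layers is put into the layer directly below the deepest
  event that depends on it, which keeps the layers stable.
\<close>

lemma insert_event:
  assumes R: "R \<in> space S" and B: "B \<in> \<B>" "R 0 \<in> outcomes B"
  shows "stable_layers \<B> P L \<Longrightarrow> layers_consistent L (advance (vars B) R) \<Longrightarrow>
    \<exists>C\<in>P \<union> \<Union>(set L). related B C \<Longrightarrow>
    \<exists>L'. stable_layers \<B> P L' \<and> layers_consistent L' R \<and> layers_table L' R = advance (vars B) (layers_table L R)"
proof (induction L arbitrary: P)
  case Nil
  with B show ?case
    by (intro exI[of _ "[{B}]"]) (auto simp: stable_def pairwise_def)
next
  case (Cons I L)
  show ?case
  proof (cases "\<exists>C\<in>I \<union> \<Union>(set L). related B C")
    case True
    \<comment> \<open>Some event in or below \<open>I\<close> is related to \<open>B\<close>, so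
      \<open>B\<close> goes into the layers below \<open>I\<close>.\<close>
    with Cons.IH[of I] Cons.prems obtain L' where
      L': "stable_layers \<B> I L'" "layers_consistent L' R" "layers_table L' R = advance (vars B) (layers_table L R)"
      by auto
    with Cons.prems show ?thesis
      by (intro exI[of _ "I # L'"]) (auto simp: layers_table_advance advance_commute)
  next
    case False
    \<comment> \<open>Only events of \<open>P\<close> are related to \<open>B\<close>, so it joins
      \<open>I\<close>; the deeper layers do not touch its variables and leave its truth on row 0
      unchanged.\<close>
    have sub: "C \<in> \<B> \<and> vars B \<inter> vars C = {}" if "J \<in> set (I # L)" "C \<in> J" for J C
      using that stable_layers_subset[OF Cons.prems(1) that(1)] False by (auto simp: related_def)
    have tab: "layers_table L R 0 \<in> outcomes B"
    proof (subst outcomes_cong[OF B(1), of _ "R 0"])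
      show "layers_table L R 0 j = R 0 j" if "j \<in> vars B" for j
        using sub that by (intro layers_table_eq) fastforce
    qed (use R B layers_table_in_space[OF R] in \<open>auto simp: space_S\<close>)
    have cons: "layers_consistent (I # L) R"
      using Cons.prems(2) layers_consistent_advance[OF R, of "I # L" "vars B"] sub by blast
    have "related B C \<Longrightarrow> C \<notin> I \<union> \<Union>(set L)" for C using False by auto
    with Cons.prems(3) have BP: "\<exists>C\<in>P. related B C" by auto
    have st: "stable (insert B I)"
      using Cons.prems(1) sub[of I] unfolding stable_def pairwise_insert by (auto simp: stable_def)
    have "stable_layers \<B> P (insert B I # L)"
      using Cons.prems(1) B st BP by (auto intro: stable_layers_mono)
    moreover have "layers_consistent (insert B I # L) R"
      using cons tab by auto
    moreover have "layers_table (insert B I # L) R = advance (vars B) (layers_table (I # L) R)"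
      using sub[of I] by (simp, subst advance_Un) auto
    ultimately show ?thesis by blast
  qed
qed

text \<open>Going back in time from the end of the word, a resampling is inserted if it is related
  to \<open>P\<close> or to the layers found so far, and dropped otherwise. A dropped one shares no
  variable with either, so the columns of \<open>P\<close> agree at every height.\<close>

lemma word_to_layers:
  assumes "P \<subseteq> \<B>" "R \<in> space S" "set w \<subseteq> \<B>" "word_consistent w R"
  shows "\<exists>L. stable_layers \<B> P L \<and> layers_consistent L R \<and>
    (\<forall>B\<in>P. \<forall>j\<in>vars B. \<forall>c. layers_table L R c j = word_table w R c j)"
  using assms(2-)
proof (induction w arbitrary: R)
  case Nil
  then show ?case by (intro exI[of _ "[]"]) auto
next
  case (Cons B w)
  have B: "B \<in> \<B>" "R 0 \<in> outcomes B" using Cons.prems by auto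
  obtain L where L: "stable_layers \<B> P L" "layers_consistent L (advance (vars B) R)"
    and tab: "\<And>C j c. C \<in> P \<Longrightarrow> j \<in> vars C \<Longrightarrow> layers_table L (advance (vars B) R) c j = word_table w (advance (vars B) R) c j"
    using Cons.IH[OF advance_in_space[OF Cons.prems(1), of "vars B"]] Cons.prems(2,3) by auto
  show ?case
  proof (cases "\<exists>C\<in>P \<union> \<Union>(set L). related B C")
    case True
    then obtain L' where "stable_layers \<B> P L'" "layers_consistent L' R"
      "layers_table L' R = advance (vars B) (layers_table L R)"
      using insert_event[OF Cons.prems(1) B L] by blast
    with tab show ?thesis by (auto simp: layers_table_advance intro!: exI[of _ L'])
  next
    case False
    then have sub: "C \<in> \<B> \<and> vars B \<inter> vars C = {}" if "J \<in> set L" "C \<in> J" for J C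
      using that stable_layers_subset[OF L(1) that(1)] by (auto simp: related_def)
    have "layers_consistent L R"
      using L(2) layers_consistent_advance[OF Cons.prems(1), of L] sub by blast
    moreover have "layers_table L R c j = word_table (B # w) R c j" if "C \<in> P" "j \<in> vars C" for C c j
    proof -
      have "j \<notin> vars B" using False that by (auto simp: related_def)
      with tab[OF that, of c] show ?thesis by (simp add: layers_table_advance advance_apply)
    qed
    ultimately show ?thesis using L(1) by blast
  qed
qed

text \<open>The deepest layer is resampled first, and each layer event by event in any order: its
  events have disjoint variables, so each stays true until its turn.\<close>

lemma layers_to_word:
  assumes "R \<in> space S" "\<And>I. I \<in> set L \<Longrightarrow> I \<subseteq> \<B> \<and> stable I" "layers_consistent L R"
  shows "\<exists>w. set w \<subseteq> \<B> \<and> word_consistent w R \<and> word_table w R = layers_table L R"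
  using assms(2-)
proof (induction L)
  case Nil
  show ?case by (intro exI[of _ "[]"]) simp
next
  case (Cons I L)
  then obtain w where w: "set w \<subseteq> \<B>" "word_consistent w R" "word_table w R = layers_table L R" by auto
  have I: "I \<subseteq> \<B>" "stable I" "\<And>B. B \<in> I \<Longrightarrow> layers_table L R 0 \<in> outcomes B" using Cons.prems by auto
  have "\<exists>w. set w \<subseteq> \<B> \<and> word_consistent w R \<and> word_table w R = advance (\<Union>B\<in>I. vars B) (layers_table L R)"
    using finite_subset[OF I(1) finite_bad] I
  proof (induction I rule: finite_induct)
    case empty
    show ?case using w by auto
  next
    case (insert B I)
    then obtain v where v: "set v \<subseteq> \<B>" "word_consistent v R"
      "word_table v R = advance (\<Union>B\<in>I. vars B) (layers_table L R)"
      by (auto simp: stable_def pairwise_insert)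
    have disj: "(\<Union>B\<in>I. vars B) \<inter> vars B = {}"
      using insert.prems(2) insert.hyps(2) by (auto simp: stable_def pairwise_insert)
    have "word_table v R 0 \<in> outcomes B"
      using insert.prems advance_outcomes[OF layers_table_in_space[OF assms(1)] _ disj] v by auto
    then show ?case using v insert.prems disj
      by (intro exI[of _ "v @ [B]"])
        (auto simp: word_table_append word_consistent_append advance_Un Int_commute)
  qed
  then show ?case by simp
qed

text \<open>
  Stopping the resamplings of consistent layers at an event \<open>C\<close> leaves the values of the
  variables of \<open>C\<close> unchanged, since the layers below \<open>C\<close> are downward closed.
\<close>

lemma restrict_layers:
  assumes "R \<in> space S" "stable_layers \<B> P L" "layers_consistent L R" "C \<in> \<B>"
  shows "\<exists>L'. stable_layers \<B> {C} L' \<and> layers_consistent L' R \<and>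
    (\<forall>j\<in>vars C. \<forall>c. layers_table L' R c j = layers_table L R c j)"
proof -
  \<comment> \<open>Linearising the layers and rebuilding them from \<open>{C}\<close> keeps only
    the resamplings that lead to \<open>C\<close>.\<close>
  obtain w where "set w \<subseteq> \<B>" "word_consistent w R" "word_table w R = layers_table L R"
    using layers_to_word[OF assms(1) _ assms(3)] stable_layers_subset[OF assms(2)] by blast
  with word_to_layers[of "{C}" R w] assms show ?thesis by auto
qed

end

section \<open>Probabilities of layers\<close>

text \<open>Each element contributes 1 if left out and \<open>x\<close> if chosen. This is used to
  sum over the choices of a next layer.\<close>

lemma sum_Pow_power:
  fixes x :: "'b :: comm_semiring_1"
  assumes "finite A"
  shows "(\<Sum>I\<in>Pow A. x ^ card I) = (1 + x) ^ card A"
  using assms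
proof (induction A)
  case (insert a A)
  have "(\<Sum>I\<in>Pow (insert a A). x ^ card I) = (\<Sum>I\<in>Pow A. x ^ card I) + (\<Sum>I\<in>insert a ` Pow A. x ^ card I)"
    unfolding Pow_insert using insert by (intro sum.union_disjoint) auto
  also have "(\<Sum>I\<in>insert a ` Pow A. x ^ card I) = (\<Sum>I\<in>Pow A. x ^ card (insert a I))"
    using insert by (intro sum.reindex_cong[of "insert a"]) (auto intro!: inj_onI)
  also have "\<dots> = (\<Sum>I\<in>Pow A. x * x ^ card I)"
    using insert by (intro sum.cong) (auto simp: card_insert_if finite_subset)
  finally show ?case
    using insert by (simp add: sum_distrib_left[symmetric] algebra_simps)
qed simp

context bad_events
begin

text \<open>By \<open>nn_integral_layers\<close> with constant \<open>g = 1\<close>, this is the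
  probability that stable layers of bad-events are consistent with a random table.\<close>

definition weight :: "'a event set list \<Rightarrow> real" where
  "weight L = (\<Prod>I\<leftarrow>L. \<Prod>B\<in>I. measure \<Omega> (outcomes B))"

lemma weight_simps [simp]:
  "weight [] = 1"
  "weight (I # L) = (\<Prod>B\<in>I. measure \<Omega> (outcomes B)) * weight L"
  by (simp_all add: weight_def)

lemma weight_nonneg: "0 \<le> weight L"
  by (induction L) (simp_all add: prod_nonneg)

lemma measurable_level: "(\<lambda>R. R c) \<in> S \<rightarrow>\<^sub>M \<Omega>"
  by (rule measurable_component_singleton) simp

lemma pred_outcomes: "B \<in> \<B> \<Longrightarrow> f \<in> N \<rightarrow>\<^sub>M \<Omega> \<Longrightarrow> Measurable.pred N (\<lambda>x. f x \<in> outcomes B)"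
  by (rule pred_sets2[OF outcomes_sets])

lemma measurable_layers_table [measurable]: "layers_table L \<in> S \<rightarrow>\<^sub>M S"
proof (induction L)
  case Nil
  have "layers_table [] = (\<lambda>R :: nat \<Rightarrow> nat \<Rightarrow> 'a. R)" by (simp add: fun_eq_iff)
  then show ?case by simp
next
  case (Cons I L)
  have "layers_table (I # L) = (\<lambda>R. advance (\<Union>B\<in>I. vars B) (layers_table L R))" by (simp add: fun_eq_iff)
  with measurable_advance[OF Cons] show ?case by (simp only:)
qed

lemma pred_stable_outcomes:
  assumes "I \<subseteq> \<B>" "f \<in> N \<rightarrow>\<^sub>M \<Omega>"
  shows "Measurable.pred N (\<lambda>x. \<forall>B\<in>I. f x \<in> outcomes B)"
proof (rule pred_intros_finite(3))
  show "finite I" using assms(1) finite_bad by (rule finite_subset)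
  show "Measurable.pred N (\<lambda>x. f x \<in> outcomes B)" if "B \<in> I" for B
    using that assms by (intro pred_outcomes) auto
qed

lemma measurable_if_stable:
  assumes "I \<subseteq> \<B>" "g \<in> borel_measurable S"
  shows "(\<lambda>R. if \<forall>B\<in>I. R 0 \<in> outcomes B then g (advance V R) else (0 :: ennreal)) \<in> borel_measurable S"
proof (rule measurable_If)
  show "(\<lambda>R. g (advance V R)) \<in> borel_measurable S"
    by (rule measurable_compose[OF _ assms(2)]) measurable
  show "{R \<in> space S. \<forall>B\<in>I. R 0 \<in> outcomes B} \<in> sets S"
    using pred_stable_outcomes[OF assms(1) measurable_level] by (simp only: pred_def)
qed simp

lemma pred_layers_consistent:
  "(\<And>I. I \<in> set L \<Longrightarrow> I \<subseteq> \<B>) \<Longrightarrow> Measurable.pred S (layers_consistent L)"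
proof (induction L)
  case Nil
  have "layers_consistent [] = (\<lambda>R :: nat \<Rightarrow> nat \<Rightarrow> 'a. True)" by (simp add: fun_eq_iff)
  then show ?case by simp
next
  case (Cons I L)
  have "layers_consistent (I # L) = (\<lambda>R. layers_consistent L R \<and> (\<forall>B\<in>I. layers_table L R 0 \<in> outcomes B))"
    by (simp add: fun_eq_iff)
  moreover have "Measurable.pred S (\<lambda>R. \<forall>B\<in>I. layers_table L R 0 \<in> outcomes B)"
    using Cons.prems by (intro pred_stable_outcomes measurable_compose[OF measurable_layers_table measurable_level]) auto
  with Cons have "Measurable.pred S (\<lambda>R. layers_consistent L R \<and> (\<forall>B\<in>I. layers_table L R 0 \<in> outcomes B))"
    by (intro pred_intros_logic) auto
  ultimately show ?case by (simp only:)
qed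

text \<open>The truth of \<open>B\<close> is read from the entries of row 0 that resampling
  \<open>B\<close> discards, so it is independent of the table left over.\<close>

lemma nn_integral_event:
  assumes "B \<in> \<B>" and g: "g \<in> borel_measurable S"
  shows "(\<integral>\<^sup>+R. (if R 0 \<in> outcomes B then g (advance (vars B) R) else 0) \<partial>S)
    = ennreal (measure \<Omega> (outcomes B)) * (\<integral>\<^sup>+R. g R \<partial>S)"
proof -
  have [measurable]: "outcomes B \<in> sets \<Omega>" using assms(1) by (rule outcomes_sets)
  have g': "(\<lambda>z. g (snd z)) \<in> borel_measurable (\<Omega> \<Otimes>\<^sub>M S)"
    using g by (rule measurable_compose[OF measurable_snd])
  have "(\<integral>\<^sup>+R. (if R 0 \<in> outcomes B then g (advance (vars B) R) else 0) \<partial>S)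
    = (\<integral>\<^sup>+x. \<integral>\<^sup>+R. (if x \<in> outcomes B then g R else 0) \<partial>S \<partial>\<Omega>)"
  proof (rule nn_integral_advance)
    show "(\<lambda>(x, R). if x \<in> outcomes B then g R else 0) \<in> borel_measurable (\<Omega> \<Otimes>\<^sub>M S)"
      unfolding split_beta'
    proof (rule measurable_If[OF g'])
      show "{z \<in> space (\<Omega> \<Otimes>\<^sub>M S). fst z \<in> outcomes B} \<in> sets (\<Omega> \<Otimes>\<^sub>M S)"
        using pred_sets2[OF outcomes_sets[OF assms(1)] measurable_fst] by (simp only: pred_def)
    qed simp
  qed (use outcomes_cong[OF assms(1)] in metis)
  also have "\<dots> = (\<integral>\<^sup>+x. (\<integral>\<^sup>+R. g R \<partial>S) * indicator (outcomes B) x \<partial>\<Omega>)"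
    by (intro nn_integral_cong) (auto simp: indicator_def)
  also have "\<dots> = (\<integral>\<^sup>+R. g R \<partial>S) * emeasure \<Omega> (outcomes B)"
    by (subst nn_integral_cmult_indicator) auto
  also have "emeasure \<Omega> (outcomes B) = ennreal (measure \<Omega> (outcomes B))"
    by (simp add: M.emeasure_eq_measure)
  finally show ?thesis by (simp add: mult.commute)
qed

text \<open>The events may be resampled one at a time: by disjointness, resampling \<open>B\<close>
  does not change the truth of the others, so the probabilities multiply.\<close>

lemma nn_integral_stable:
  assumes "I \<subseteq> \<B>" "stable I" and "g \<in> borel_measurable S"
  shows "(\<integral>\<^sup>+R. (if \<forall>B\<in>I. R 0 \<in> outcomes B then g (advance (\<Union>B\<in>I. vars B) R) else 0) \<partial>S)
    = ennreal (\<Prod>B\<in>I. measure \<Omega> (outcomes B)) * (\<integral>\<^sup>+R. g R \<partial>S)"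
  using finite_subset[OF assms(1) finite_bad] assms
proof (induction I rule: finite_induct)
  case empty
  then show ?case by simp
next
  case (insert B I)
  let ?h = "\<lambda>R. if \<forall>B\<in>I. R 0 \<in> outcomes B then g (advance (\<Union>B\<in>I. vars B) R) else 0"
  have disj: "vars B \<inter> vars C = {}" if "C \<in> I" for C
    using insert that by (auto simp: stable_def pairwise_insert)
  have I: "I \<subseteq> \<B>" "stable I" and B: "B \<in> \<B>"
    using insert.prems by (auto simp: stable_def pairwise_insert)
  have h: "?h \<in> borel_measurable S"
    by (intro measurable_if_stable I(1) insert.prems(3))
  have "(if \<forall>C\<in>insert B I. R 0 \<in> outcomes C then g (advance (\<Union>C\<in>insert B I. vars C) R) else 0)
      = (if R 0 \<in> outcomes B then ?h (advance (vars B) R) else 0)" if "R \<in> space S" for R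
  proof -
    have "advance (\<Union>C\<in>insert B I. vars C) R = advance (\<Union>C\<in>I. vars C) (advance (vars B) R)"
      using disj by (subst advance_Un) (auto simp: Un_commute)
    moreover have "(\<forall>C\<in>I. advance (vars B) R 0 \<in> outcomes C) \<longleftrightarrow> (\<forall>C\<in>I. R 0 \<in> outcomes C)"
      using advance_outcomes[OF that] I(1) disj by blast
    ultimately show ?thesis by simp
  qed
  then have "(\<integral>\<^sup>+R. (if \<forall>C\<in>insert B I. R 0 \<in> outcomes C then g (advance (\<Union>C\<in>insert B I. vars C) R) else 0) \<partial>S)
    = (\<integral>\<^sup>+R. (if R 0 \<in> outcomes B then ?h (advance (vars B) R) else 0) \<partial>S)"
    by (rule nn_integral_cong)
  also have "\<dots> = ennreal (measure \<Omega> (outcomes B)) * (\<integral>\<^sup>+R. ?h R \<partial>S)"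
    by (rule nn_integral_event[OF B h])
  also have "(\<integral>\<^sup>+R. ?h R \<partial>S) = ennreal (\<Prod>B\<in>I. measure \<Omega> (outcomes B)) * (\<integral>\<^sup>+R. g R \<partial>S)"
    by (rule insert.IH[OF I insert.prems(3)])
  finally show ?case using insert.hyps
    by (simp add: ennreal_mult prod_nonneg mult.assoc)
qed

text \<open>The function \<open>g\<close> varies in the induction because the head layer, which is
  resampled last, is absorbed into it before the earlier layers are treated.\<close>

lemma nn_integral_layers:
  assumes "\<And>I. I \<in> set L \<Longrightarrow> I \<subseteq> \<B> \<and> stable I" and "g \<in> borel_measurable S"
  shows "(\<integral>\<^sup>+R. (if layers_consistent L R then g (layers_table L R) else 0) \<partial>S)
    = ennreal (weight L) * (\<integral>\<^sup>+R. g R \<partial>S)"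
  using assms
proof (induction L arbitrary: g)
  case Nil
  then show ?case by simp
next
  case (Cons I L)
  let ?h = "\<lambda>R. if \<forall>B\<in>I. R 0 \<in> outcomes B then g (advance (\<Union>B\<in>I. vars B) R) else 0"
  have I: "I \<subseteq> \<B>" "stable I" using Cons.prems by auto
  have h: "?h \<in> borel_measurable S"
    by (intro measurable_if_stable I(1) Cons.prems(2))
  have "(\<integral>\<^sup>+R. (if layers_consistent (I # L) R then g (layers_table (I # L) R) else 0) \<partial>S)
     = (\<integral>\<^sup>+R. (if layers_consistent L R then ?h (layers_table L R) else 0) \<partial>S)"
    by (intro nn_integral_cong) simp
  also have "\<dots> = ennreal (weight L) * (\<integral>\<^sup>+R. ?h R \<partial>S)"
    using Cons.prems by (intro Cons.IH h) auto
  also have "(\<integral>\<^sup>+R. ?h R \<partial>S) = ennreal (\<Prod>B\<in>I. measure \<Omega> (outcomes B)) * (\<integral>\<^sup>+R. g R \<partial>S)"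
    by (rule nn_integral_stable[OF I Cons.prems(2)])
  finally show ?case
    by (simp add: ennreal_mult prod_nonneg weight_nonneg mult_ac)
qed

lemma layers_event_sets:
  assumes "\<And>I. I \<in> set L \<Longrightarrow> I \<subseteq> \<B>" and [measurable]: "E \<in> sets \<Omega>" "F \<in> sets \<Omega>"
  shows "{R \<in> space S. layers_consistent L R \<and> layers_table L R 0 \<in> E \<and> layers_table L R 1 \<in> F} \<in> sets S"
proof -
  have [measurable]: "Measurable.pred S (layers_consistent L)"
    using assms(1) by (rule pred_layers_consistent)
  show ?thesis by measurable
qed

text \<open>The table left by the layers is again fresh, and its rows 0 and 1 are independent. In
  the application, row 0 decides which event is true and row 1 holds the values drawn when it is
  resampled.\<close>

lemma emeasure_layers_event:
  assumes L: "\<And>I. I \<in> set L \<Longrightarrow> I \<subseteq> \<B> \<and> stable I" and E: "E \<in> sets \<Omega>" and F: "F \<in> sets \<Omega>"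
  shows "emeasure S {R \<in> space S. layers_consistent L R \<and> layers_table L R 0 \<in> E \<and> layers_table L R 1 \<in> F}
    = ennreal (weight L * measure \<Omega> E * measure \<Omega> F)"
proof -
  let ?g = "\<lambda>R. if R 0 \<in> E \<and> R 1 \<in> F then 1 else 0 :: ennreal"
  have [measurable]: "E \<in> sets \<Omega>" "F \<in> sets \<Omega>" using E F by auto
  have g: "?g \<in> borel_measurable S" by measurable
  have meas: "{R \<in> space S. layers_consistent L R \<and> layers_table L R 0 \<in> E \<and> layers_table L R 1 \<in> F} \<in> sets S"
    using L E F by (intro layers_event_sets) auto
  have "(\<integral>\<^sup>+R. ?g R \<partial>S) = (\<integral>\<^sup>+x. \<integral>\<^sup>+y. indicator E x * indicator F y \<partial>\<Omega> \<partial>\<Omega>)"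
  proof (subst nn_integral_S_split[OF g], rule nn_integral_cong)
    fix x assume "x \<in> space \<Omega>"
    have "(\<integral>\<^sup>+R. ?g (case_nat x R) \<partial>S) = (\<integral>\<^sup>+R. indicator E x * indicator F (R 0) \<partial>S)"
      by (intro nn_integral_cong) (auto simp: indicator_def)
    also have "\<dots> = (\<integral>\<^sup>+y. \<integral>\<^sup>+R. indicator E x * indicator F y \<partial>S \<partial>\<Omega>)"
      by (subst nn_integral_S_split) auto
    finally show "(\<integral>\<^sup>+R. ?g (case_nat x R) \<partial>S) = (\<integral>\<^sup>+y. indicator E x * indicator F y \<partial>\<Omega>)"
      by (simp add: emeasure_space_1)
  qed
  also have "\<dots> = ennreal (measure \<Omega> E * measure \<Omega> F)"
    by (simp add: nn_integral_cmult nn_integral_multc M.emeasure_eq_measure ennreal_mult)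
  finally have int: "(\<integral>\<^sup>+R. ?g R \<partial>S) = ennreal (measure \<Omega> E * measure \<Omega> F)" .
  have "emeasure S {R \<in> space S. layers_consistent L R \<and> layers_table L R 0 \<in> E \<and> layers_table L R 1 \<in> F}
     = (\<integral>\<^sup>+R. (if layers_consistent L R then ?g (layers_table L R) else 0) \<partial>S)"
    by (subst nn_integral_indicator[OF meas, symmetric], intro nn_integral_cong) (auto simp: indicator_def)
  also have "\<dots> = ennreal (weight L) * (\<integral>\<^sup>+R. ?g R \<partial>S)"
    by (rule nn_integral_layers[OF L g])
  finally show ?thesis
    unfolding int by (simp add: ennreal_mult weight_nonneg mult.assoc)
qed

section \<open>Total weight of layers under the symmetric criterion\<close>

text \<open>The length bound makes the sums finite; \<open>emeasure_UN_witness_event\<close> removes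
  it by a limit.\<close>

definition layers_upto :: "nat \<Rightarrow> 'a event set \<Rightarrow> 'a event set list set" where
  "layers_upto h P = {L. stable_layers \<B> P L \<and> length L \<le> h}"

lemma finite_layers_upto: "finite (layers_upto h P)"
proof (rule finite_subset)
  show "layers_upto h P \<subseteq> {L. set L \<subseteq> Pow \<B> \<and> length L \<le> h}"
    using stable_layers_subset by (auto simp: layers_upto_def) blast
  show "finite {L. set L \<subseteq> Pow \<B> \<and> length L \<le> h}"
    using finite_bad by (intro finite_lists_length_le) simp
qed

text \<open>By induction, lists with first layer \<open>I\<close> have total weight at most
  \<open>(p * exp (exp 1 * p * d)) ^ card I\<close>, hence at most
  \<open>(exp 1 * p) ^ card I\<close>. Summing over all subsets of the at most
  \<open>d * card P\<close> neighbours gives \<open>(1 + exp 1 * p) ^ card N\<close>, and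
  \<open>1 + x \<le> exp x\<close> closes the induction.\<close>

lemma sum_weight_le:
  assumes p: "\<And>B. B \<in> \<B> \<Longrightarrow> measure \<Omega> (outcomes B) \<le> p" and "0 \<le> p"
    and d: "\<And>B. B \<in> \<B> \<Longrightarrow> real (card (nbhd \<B> B)) \<le> d"
    and epd: "exp 1 * p * d \<le> 1"
  shows "P \<subseteq> \<B> \<Longrightarrow> (\<Sum>L\<in>layers_upto h P. weight L) \<le> exp (exp 1 * p * d) ^ card P"
proof (induction h arbitrary: P)
  case 0
  \<comment> \<open>Only \<open>[]\<close> has length 0, with weight 1. A member of \<open>P\<close>
    forces \<open>d\<close> to be nonnegative, as it bounds a cardinality.\<close>
  have "1 \<le> exp (exp 1 * p * d) ^ card P" if "P \<noteq> {}"
  proof -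
    from that 0 obtain B where "B \<in> \<B>" by auto
    from d[OF this] have "0 \<le> d" by linarith
    with \<open>0 \<le> p\<close> show ?thesis by (intro one_le_power) simp
  qed
  moreover have "layers_upto 0 P = {[]}" by (auto simp: layers_upto_def)
  ultimately show ?case by (cases "P = {}") auto
next
  case (Suc h)
  let ?x = "exp (exp 1 * p * d)"
  define N where "N = (\<Union>C\<in>P. nbhd \<B> C)"
  define J where "J = {I. I \<subseteq> N \<and> I \<noteq> {} \<and> stable I}"
  have finP: "finite P" using Suc.prems finite_bad by (rule finite_subset)
  have "N \<subseteq> \<B>" by (auto simp: N_def nbhd_def)
  have finN: "finite N" using \<open>N \<subseteq> \<B>\<close> finite_bad by (rule finite_subset)
  have J: "J \<subseteq> Pow N - {{}}" by (auto simp: J_def)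
  have finJ: "finite J" using J finN by (meson finite_Diff finite_Pow_iff finite_subset)
  have cardN: "real (card N) \<le> d * real (card P)"
  proof -
    have "card N \<le> (\<Sum>C\<in>P. card (nbhd \<B> C))" unfolding N_def using finP by (rule card_UN_le)
    then have "real (card N) \<le> (\<Sum>C\<in>P. real (card (nbhd \<B> C)))" by (metis of_nat_le_iff of_nat_sum)
    also have "\<dots> \<le> (\<Sum>C\<in>P. d)" using d Suc.prems by (intro sum_mono) auto
    finally show ?thesis by (simp add: mult.commute)
  qed
  have N: "I \<subseteq> N \<longleftrightarrow> I \<subseteq> \<B> \<and> (\<forall>B\<in>I. \<exists>C\<in>P. related B C)" for I
    unfolding N_def nbhd_def by blast
  have step: "layers_upto (Suc h) P = insert [] (\<Union>I\<in>J. (#) I ` layers_upto h I)"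
  proof (rule set_eqI)
    fix L
    show "L \<in> layers_upto (Suc h) P \<longleftrightarrow> L \<in> insert [] (\<Union>I\<in>J. (#) I ` layers_upto h I)"
    proof (cases L)
      case Nil
      then show ?thesis by (simp add: layers_upto_def)
    next
      case (Cons I L')
      then show ?thesis by (simp add: layers_upto_def J_def N image_iff) blast
    qed
  qed
  have bound: "(\<Prod>B\<in>I. measure \<Omega> (outcomes B)) * (\<Sum>L\<in>layers_upto h I. weight L) \<le> (exp 1 * p) ^ card I"
    if "I \<in> J" for I
  proof -
    have I: "I \<subseteq> \<B>" using that by (simp add: J_def N)
    have "(\<Prod>B\<in>I. measure \<Omega> (outcomes B)) \<le> (\<Prod>B\<in>I. p)"
      using p I by (intro prod_mono) auto
    then have "(\<Prod>B\<in>I. measure \<Omega> (outcomes B)) * (\<Sum>L\<in>layers_upto h I. weight L) \<le> p ^ card I * ?x ^ card I"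
      using \<open>0 \<le> p\<close> by (intro mult_mono Suc.IH I) (simp_all add: sum_nonneg weight_nonneg)
    also have "\<dots> = (p * ?x) ^ card I" by (simp only: power_mult_distrib)
    also have "\<dots> \<le> (exp 1 * p) ^ card I"
    proof (rule power_mono)
      \<comment> \<open>The criterion enters here: it bounds the factor contributed by the deeper
        layers by \<open>exp 1\<close>.\<close>
      have "p * ?x \<le> p * exp 1" using epd \<open>0 \<le> p\<close> by (intro mult_left_mono) simp_all
      then show "p * ?x \<le> exp 1 * p" by (simp only: mult.commute)
    qed (use \<open>0 \<le> p\<close> in simp)
    finally show ?thesis .
  qed
  have "(\<Sum>L\<in>layers_upto (Suc h) P. weight L) = 1 + (\<Sum>L\<in>(\<Union>I\<in>J. (#) I ` layers_upto h I). weight L)"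
    unfolding step by (subst sum.insert) (auto simp: finJ finite_layers_upto)
  also have "(\<Sum>L\<in>(\<Union>I\<in>J. (#) I ` layers_upto h I). weight L) = (\<Sum>I\<in>J. \<Sum>L\<in>(#) I ` layers_upto h I. weight L)"
    by (rule sum.UNION_disjoint) (auto simp: finJ finite_layers_upto)
  also have "\<dots> = (\<Sum>I\<in>J. (\<Prod>B\<in>I. measure \<Omega> (outcomes B)) * (\<Sum>L\<in>layers_upto h I. weight L))"
    by (intro sum.cong refl, subst sum.reindex) (simp_all add: sum_distrib_left)
  finally have "(\<Sum>L\<in>layers_upto (Suc h) P. weight L) \<le> 1 + (\<Sum>I\<in>J. (exp 1 * p) ^ card I)"
    using sum_mono[OF bound] by simp
  also have "\<dots> \<le> 1 + (\<Sum>I\<in>Pow N - {{}}. (exp 1 * p) ^ card I)"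
    using J finN \<open>0 \<le> p\<close> by (intro add_left_mono sum_mono2) simp_all
  \<comment> \<open>The leading 1, contributed by \<open>[]\<close>, is the term of the empty
    set.\<close>
  also have "\<dots> = (\<Sum>I\<in>Pow N. (exp 1 * p) ^ card I)"
    using finN by (subst sum.remove[of "Pow N" "{}"]) simp_all
  also have "\<dots> = (1 + exp 1 * p) ^ card N"
    using finN by (rule sum_Pow_power)
  also have "\<dots> \<le> exp (exp 1 * p) ^ card N"
    using \<open>0 \<le> p\<close> by (intro power_mono) simp_all
  also have "\<dots> = exp (real (card N) * (exp 1 * p))"
    by (simp only: exp_of_nat_mult)
  also have "\<dots> \<le> exp (d * real (card P) * (exp 1 * p))"
    using mult_right_mono[OF cardN, of "exp 1 * p"] \<open>0 \<le> p\<close> by simp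
  also have "d * real (card P) * (exp 1 * p) = real (card P) * (exp 1 * p * d)" by simp
  also have "exp \<dots> = ?x ^ card P"
    by (simp only: exp_of_nat_mult)
  finally show ?case .
qed

end

section \<open>Running on fresh samples and on a table\<close>

text \<open>The recursion consumes samples from the front, in step with splitting off row 0 of a
  table. As \<open>mt_history\<close> extends at the end instead, \<open>sample_run_Suc\<close>
  reconciles the two.\<close>

primrec sample_run ::
  "(nat \<Rightarrow> (nat \<Rightarrow> nat \<Rightarrow> 'a) \<Rightarrow> 'a event) \<Rightarrow> nat \<Rightarrow> nat \<Rightarrow> (nat \<Rightarrow> nat \<Rightarrow> 'a) \<Rightarrow> (nat \<Rightarrow> nat \<Rightarrow> 'a) \<Rightarrow> nat \<Rightarrow> nat \<Rightarrow> 'a"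
where
  "sample_run \<tau> 0 t h y = h"
| "sample_run \<tau> (Suc k) t h y =
     sample_run \<tau> k (Suc t) (h(Suc t := resample (vars (\<tau> t h)) (h t) (y 0))) (\<lambda>s. y (Suc s))"

text \<open>In use, row 0 of \<open>Q\<close> is the state \<open>h t\<close>, and each column
  continues with the samples not yet used by its variable.\<close>

primrec table_run ::
  "(nat \<Rightarrow> (nat \<Rightarrow> nat \<Rightarrow> 'a) \<Rightarrow> 'a event) \<Rightarrow> nat \<Rightarrow> nat \<Rightarrow> (nat \<Rightarrow> nat \<Rightarrow> 'a) \<Rightarrow> (nat \<Rightarrow> nat \<Rightarrow> 'a) \<Rightarrow> nat \<Rightarrow> nat \<Rightarrow> 'a"
where
  "table_run \<tau> 0 t h Q = h"
| "table_run \<tau> (Suc k) t h Q =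
     table_run \<tau> k (Suc t) (h(Suc t := advance (vars (\<tau> t h)) Q 0)) (advance (vars (\<tau> t h)) Q)"

lemma sample_run_Suc:
  "sample_run \<tau> (Suc k) t h y =
    (sample_run \<tau> k t h y)(Suc (t + k) :=
       resample (vars (\<tau> (t + k) (sample_run \<tau> k t h y))) (sample_run \<tau> k t h y (t + k)) (y k))"
proof (induction k arbitrary: t h y)
  case (Suc k)
  show ?case
    by (subst sample_run.simps(2), subst Suc.IH) simp
qed simp

text \<open>A deterministic rule, such as one with its seed fixed. The dummy
  \<open>Event {} {}\<close> resamples nothing, so a terminated run idles and can be continued for
  any number of steps; the finite range makes compositions with the rule measurable.\<close>

locale resampling_rule = bad_events n M \<B> for n and M :: "nat \<Rightarrow> 'a measure" and \<B> +
  fixes \<tau> :: "nat \<Rightarrow> (nat \<Rightarrow> nat \<Rightarrow> 'a) \<Rightarrow> 'a event"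
  assumes measurable_rule: "\<tau> t \<in> PiM {..t} (\<lambda>_. \<Omega>) \<rightarrow>\<^sub>M count_space (insert (Event {} {}) \<B>)"
    and rule_selects: "h \<in> space (PiM {..t} (\<lambda>_. \<Omega>)) \<Longrightarrow> \<exists>B\<in>\<B>. h t \<in> outcomes B \<Longrightarrow>
      \<tau> t h \<in> \<B> \<and> h t \<in> outcomes (\<tau> t h)"
    and rule_idle: "\<forall>B\<in>\<B>. h t \<notin> outcomes B \<Longrightarrow> \<tau> t h = Event {} {}"
begin

abbreviation "H t \<equiv> PiM {..t :: nat} (\<lambda>_. \<Omega>)"

lemma measurable_history_upd:
  assumes "f \<in> N \<rightarrow>\<^sub>M H t" "g \<in> N \<rightarrow>\<^sub>M \<Omega>"
  shows "(\<lambda>x. (f x)(Suc t := g x)) \<in> N \<rightarrow>\<^sub>M H (Suc t)"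
  by (rule measurable_fun_upd[OF _ assms]) auto

lemma history_upd_in_space: "h \<in> space (H t) \<Longrightarrow> x \<in> space \<Omega> \<Longrightarrow> h(Suc t := x) \<in> space (H (Suc t))"
  by (auto simp: space_PiM PiE_iff extensional_def)

lemma measurable_history_apply:
  assumes "f \<in> N \<rightarrow>\<^sub>M H t"
  shows "(\<lambda>x. f x t) \<in> N \<rightarrow>\<^sub>M \<Omega>"
  by (rule measurable_compose[OF assms measurable_component_singleton]) simp

lemma countable_events: "countable (insert (Event {} {}) \<B>)"
  using finite_bad by (simp add: countable_finite)

lemma measurable_rule_resample:
  assumes "f \<in> N \<rightarrow>\<^sub>M H t" "g \<in> N \<rightarrow>\<^sub>M \<Omega>"
  shows "(\<lambda>x. resample (vars (\<tau> t (f x))) (f x t) (g x)) \<in> N \<rightarrow>\<^sub>M \<Omega>"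
  by (rule measurable_compose_countable'[OF _ measurable_compose[OF assms(1) measurable_rule] countable_events])
    (intro measurable_resample measurable_history_apply assms)

lemma measurable_rule_advance:
  assumes "f \<in> N \<rightarrow>\<^sub>M H t" "g \<in> N \<rightarrow>\<^sub>M S"
  shows "(\<lambda>x. advance (vars (\<tau> t (f x))) (g x)) \<in> N \<rightarrow>\<^sub>M S"
  by (rule measurable_compose_countable'[OF _ measurable_compose[OF assms(1) measurable_rule] countable_events])
    (intro measurable_advance assms)

lemma measurable_sample_run:
  assumes "f \<in> N \<rightarrow>\<^sub>M H t" "g \<in> N \<rightarrow>\<^sub>M S"
  shows "(\<lambda>x. sample_run \<tau> k t (f x) (g x)) \<in> N \<rightarrow>\<^sub>M H (t + k)"
  using assms
proof (induction k arbitrary: t f g)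
  case 0
  then show ?case by simp
next
  case (Suc k)
  have "(\<lambda>x. g x 0) \<in> N \<rightarrow>\<^sub>M \<Omega>"
    by (rule measurable_compose[OF Suc.prems(2) measurable_level])
  then have upd: "(\<lambda>x. (f x)(Suc t := resample (vars (\<tau> t (f x))) (f x t) (g x 0))) \<in> N \<rightarrow>\<^sub>M H (Suc t)"
    by (intro measurable_history_upd measurable_rule_resample Suc.prems)
  have "(\<lambda>x s. g x (Suc s)) \<in> N \<rightarrow>\<^sub>M S"
    by (rule measurable_compose[OF Suc.prems(2) measurable_tail])
  from Suc.IH[OF upd this] show ?case by (simp only: sample_run.simps add_Suc_shift)
qed

lemma measurable_table_run:
  assumes "f \<in> N \<rightarrow>\<^sub>M H t" "g \<in> N \<rightarrow>\<^sub>M S"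
  shows "(\<lambda>x. table_run \<tau> k t (f x) (g x)) \<in> N \<rightarrow>\<^sub>M H (t + k)"
  using assms
proof (induction k arbitrary: t f g)
  case 0
  then show ?case by simp
next
  case (Suc k)
  have adv: "(\<lambda>x. advance (vars (\<tau> t (f x))) (g x)) \<in> N \<rightarrow>\<^sub>M S"
    by (intro measurable_rule_advance Suc.prems)
  then have "(\<lambda>x. (f x)(Suc t := advance (vars (\<tau> t (f x))) (g x) 0)) \<in> N \<rightarrow>\<^sub>M H (Suc t)"
    by (intro measurable_history_upd Suc.prems measurable_compose[OF adv measurable_level])
  from Suc.IH[OF this adv] show ?case by (simp only: table_run.simps add_Suc_shift)
qed

text \<open>
  Reading fresh samples and reading successive entries of a table produce the same law: after
  each step, the current state and the unread part of the table are independent given the past.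
\<close>

lemma nn_integral_sample_run:
  assumes "h \<in> space (H t)" "F \<in> borel_measurable (H (t + k))"
  shows "(\<integral>\<^sup>+y. F (sample_run \<tau> k t h y) \<partial>S) = (\<integral>\<^sup>+R. F (table_run \<tau> k t h (case_nat (h t) R)) \<partial>S)"
  using assms
proof (induction k arbitrary: t h)
  case 0
  then show ?case by simp
next
  case (Suc k)
  define V where "V = vars (\<tau> t h)"
  define ext where "ext x = h(Suc t := resample V (h t) x)" for x
  define g where "g x R = F (table_run \<tau> k (Suc t) (ext x) (case_nat (resample V (h t) x) R))" for x R
  have F: "F \<in> borel_measurable (H (Suc t + k))" using Suc.prems(2) by simp
  have h: "(\<lambda>_. h) \<in> N \<rightarrow>\<^sub>M H t" for N :: "'z measure" using Suc.prems(1) by simp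
  have ht: "h t \<in> space \<Omega>" using Suc.prems(1) by (auto simp: space_PiM PiE_iff)
  have ext: "ext x \<in> space (H (Suc t))" if "x \<in> space \<Omega>" for x
    unfolding ext_def by (intro history_upd_in_space Suc.prems resample_in_space ht that)
  have meas: "(\<lambda>R. F (sample_run \<tau> (Suc k) t h R)) \<in> borel_measurable S"
    by (rule measurable_compose[OF _ Suc.prems(2)]) (intro measurable_sample_run h, simp)
  have fst_meas: "(\<lambda>z. resample V (h t) (fst z)) \<in> \<Omega> \<Otimes>\<^sub>M S \<rightarrow>\<^sub>M \<Omega>"
    by (intro measurable_resample measurable_fst) (simp add: ht)
  have "(\<integral>\<^sup>+y. F (sample_run \<tau> (Suc k) t h y) \<partial>S) = (\<integral>\<^sup>+x. \<integral>\<^sup>+R. F (sample_run \<tau> k (Suc t) (ext x) R) \<partial>S \<partial>\<Omega>)"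
    by (subst nn_integral_S_split[OF meas]) (simp add: ext_def V_def)
  also have "\<dots> = (\<integral>\<^sup>+x. \<integral>\<^sup>+R. F (table_run \<tau> k (Suc t) (ext x) (case_nat (ext x (Suc t)) R)) \<partial>S \<partial>\<Omega>)"
    by (intro nn_integral_cong Suc.IH ext F)
  also have "\<dots> = (\<integral>\<^sup>+x. \<integral>\<^sup>+R. g x R \<partial>S \<partial>\<Omega>)"
    by (simp add: g_def ext_def)
  \<comment> \<open>The fresh sample enters \<open>g\<close> only through its entries in
    \<open>V\<close>, so it may be exchanged for the next table entries of \<open>V\<close>.\<close>
  also have "\<dots> = (\<integral>\<^sup>+R. g (R 0) (advance V R) \<partial>S)"
  proof (rule nn_integral_advance[symmetric])
    show "(\<lambda>(x, R). g x R) \<in> borel_measurable (\<Omega> \<Otimes>\<^sub>M S)"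
      unfolding g_def ext_def split_beta'
      by (rule measurable_compose[OF measurable_table_run F])
        (intro measurable_history_upd h measurable_case_nat_S fst_meas measurable_snd)+
    show "g x R = g y R" if "\<forall>j\<in>V. x j = y j" for x y R
    proof -
      have "resample V (h t) x = resample V (h t) y" using that by (auto simp: resample_def)
      then show ?thesis by (simp only: g_def ext_def)
    qed
  qed
  also have "\<dots> = (\<integral>\<^sup>+R. F (table_run \<tau> (Suc k) t h (case_nat (h t) R)) \<partial>S)"
    by (simp add: g_def ext_def V_def advance_case_nat)
  finally show ?case .
qed

text \<open>At the first step that gives variable \<open>i\<close> a value in \<open>D\<close>, the
  resampled event contains \<open>i\<close> and the next entry of column \<open>i\<close> lies in
  \<open>D\<close>. The word lists the resamplings before that step, without idle steps.\<close>

lemma table_run_reaches: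
  assumes "Q \<in> space S" "h \<in> space (H t)" "h t = Q 0"
    and "table_run \<tau> k t h Q (t + k) i \<in> D" "Q 0 i \<notin> D"
  shows "\<exists>w B. set w \<subseteq> \<B> \<and> word_consistent w Q \<and> B \<in> \<B> \<and> i \<in> vars B \<and>
    word_table w Q 0 \<in> outcomes B \<and> word_table w Q 0 i \<notin> D \<and> word_table w Q 1 i \<in> D"
  using assms
proof (induction k arbitrary: t h Q)
  case 0
  then show ?case by simp
next
  case (Suc k)
  define V where "V = vars (\<tau> t h)"
  define Q' where "Q' = advance V Q"
  define h' where "h' = h(Suc t := Q' 0)"
  have Q': "Q' \<in> space S" unfolding Q'_def by (intro advance_in_space Suc.prems)
  then have h': "h' \<in> space (H (Suc t))" unfolding h'_def
    by (intro history_upd_in_space Suc.prems) (simp add: space_S)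
  have run: "table_run \<tau> k (Suc t) h' Q' (Suc t + k) i \<in> D"
    using Suc.prems(4) by (simp add: h'_def Q'_def V_def)
  have IH: "\<exists>w B. set w \<subseteq> \<B> \<and> word_consistent w Q' \<and> B \<in> \<B> \<and> i \<in> vars B \<and>
    word_table w Q' 0 \<in> outcomes B \<and> word_table w Q' 0 i \<notin> D \<and> word_table w Q' 1 i \<in> D" if "Q' 0 i \<notin> D"
    by (rule Suc.IH[OF Q' h' _ run that]) (simp add: h'_def)
  show ?case
  proof (cases "\<exists>B\<in>\<B>. h t \<in> outcomes B")
    case False
    then have "V = {}" using rule_idle[of h t] by (simp add: V_def)
    then have "Q' = Q" by (simp add: Q'_def)
    with IH Suc.prems(5) show ?thesis by simp
  next
    case True
    define B where "B = \<tau> t h"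
    have B: "B \<in> \<B>" "Q 0 \<in> outcomes B"
      using rule_selects[OF Suc.prems(2) True] Suc.prems(3) by (simp_all add: B_def)
    show ?thesis
    proof (cases "Q' 0 i \<in> D")
      case D: True
      with Suc.prems(5) have "i \<in> vars B \<and> Q 1 i \<in> D"
        by (auto simp: Q'_def V_def B_def advance_apply split: if_splits)
      with B Suc.prems(5) show ?thesis by (intro exI[of _ "[]"] exI[of _ B]) simp
    next
      case D: False
      from IH[OF D] obtain w C where "set w \<subseteq> \<B>" "word_consistent w Q'" "C \<in> \<B>" "i \<in> vars C"
        "word_table w Q' 0 \<in> outcomes C" "word_table w Q' 0 i \<notin> D" "word_table w Q' 1 i \<in> D" by blast
      with B show ?thesis
        by (intro exI[of _ "B # w"] exI[of _ C]) (simp add: Q'_def V_def B_def)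
    qed
  qed
qed

end

section \<open>Witnesses in the table\<close>

context bad_events
begin

lemma value_set_measurable:
  assumes "i \<in> {1..n}" "D \<in> sets (M i)"
  shows "{x \<in> space \<Omega>. x i \<in> D} \<in> sets \<Omega>"
  unfolding Omega_def
  by (rule measurable_sets_Collect[OF measurable_component_singleton[OF assms(1)]])
    (use assms(2) sets.sets_into_space[OF assms(2)] in \<open>auto simp: Int_absorb2 Collect_conj_eq\<close>)

text \<open>
  The layers are required to end in the first event of \<open>bs\<close> that holds, so that the bound involves
  the probability of the union of \<open>bs\<close> rather than a sum of probabilities.
\<close>

definition first_event :: "'a event list \<Rightarrow> nat \<Rightarrow> (nat \<Rightarrow> 'a) set" where
  "first_event bs k = outcomes (bs ! k) - (\<Union>j<k. outcomes (bs ! j))"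

definition witness_event :: "'a event list \<Rightarrow> (nat \<Rightarrow> 'a) set \<Rightarrow> nat \<Rightarrow> (nat \<Rightarrow> nat \<Rightarrow> 'a) set" where
  "witness_event bs F h = (\<Union>k<length bs. \<Union>L\<in>layers_upto h {bs ! k}.
     {R \<in> space S. layers_consistent L R \<and> layers_table L R 0 \<in> first_event bs k \<and> layers_table L R 1 \<in> F})"

text \<open>The word gives layers for one event. The least index is then taken over all events of
  \<open>bs\<close> that have layers anywhere in the table, without reference to a run.\<close>

lemma witness_event_cover:
  assumes R: "R \<in> space S" and bs: "set bs \<subseteq> \<B>" "\<And>B. B \<in> set bs \<Longrightarrow> i \<in> vars B"
    and w: "set w \<subseteq> \<B>" "word_consistent w R" "B \<in> set bs" "word_table w R 0 \<in> outcomes B" "word_table w R 1 i \<in> D"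
  shows "\<exists>h. R \<in> witness_event bs {x \<in> space \<Omega>. x i \<in> D} h"
proof -
  define hit where "hit C L \<longleftrightarrow> stable_layers \<B> {C} L \<and> layers_consistent L R \<and>
    layers_table L R 0 \<in> outcomes C \<and> layers_table L R 1 i \<in> D" for C L
  \<comment> \<open>Row 0 on \<open>vars C\<close> decides the truth of \<open>C\<close>, and row 1
    is read only in column \<open>i\<close>, which belongs to \<open>vars C\<close>.\<close>
  have agree: "layers_table L R 0 \<in> outcomes C \<and> layers_table L R 1 i \<in> D"
    if "C \<in> set bs" "Q \<in> space S" "\<And>j c. j \<in> vars C \<Longrightarrow> layers_table L R c j = Q c j" "Q 0 \<in> outcomes C" "Q 1 i \<in> D"
    for C L and Q :: "nat \<Rightarrow> nat \<Rightarrow> 'a"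
  proof
    have "C \<in> \<B>" "i \<in> vars C" using that bs by auto
    have "layers_table L R 0 \<in> space \<Omega>" "Q 0 \<in> space \<Omega>"
      using layers_table_in_space[OF R] that(2) unfolding space_S by blast+
    with outcomes_cong[OF \<open>C \<in> \<B>\<close>, of "layers_table L R 0" "Q 0"] that(3,4)
    show "layers_table L R 0 \<in> outcomes C" by blast
    show "layers_table L R 1 i \<in> D" using that(3)[OF \<open>i \<in> vars C\<close>, of 1] that(5) by metis
  qed
  obtain k0 where k0: "k0 < length bs" "bs ! k0 = B" using w(3) by (auto simp: in_set_conv_nth)
  have "\<exists>L. stable_layers \<B> {B} L \<and> layers_consistent L R \<and>
    (\<forall>j\<in>vars B. \<forall>c. layers_table L R c j = word_table w R c j)"
    using word_to_layers[OF _ R w(1,2), of "{B}"] w(3) bs(1) by auto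
  then obtain L0 where "stable_layers \<B> {B} L0" "layers_consistent L0 R"
    "\<And>j c. j \<in> vars B \<Longrightarrow> layers_table L0 R c j = word_table w R c j"
    by blast
  with agree[OF w(3) word_table_in_space[OF R, of w]] w have "hit (bs ! k0) L0" by (simp add: hit_def k0)
  with k0 have ex: "\<exists>k. k < length bs \<and> (\<exists>L. hit (bs ! k) L)" by blast
  define k where "k = (LEAST k. k < length bs \<and> (\<exists>L. hit (bs ! k) L))"
  from LeastI_ex[OF ex] obtain L where k: "k < length bs" and L: "hit (bs ! k) L"
    by (auto simp: k_def)
  have "layers_table L R 0 \<notin> outcomes (bs ! j)" if "j < k" for j
  proof
    assume C: "layers_table L R 0 \<in> outcomes (bs ! j)"
    have j: "bs ! j \<in> set bs" using that k by simp
    \<comment> \<open>The restricted layers keep the columns of \<open>bs ! j\<close>, among them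
      column \<open>i\<close>, so the smaller index \<open>j\<close> would be hit as well.\<close>
    have "\<exists>L'. stable_layers \<B> {bs ! j} L' \<and> layers_consistent L' R \<and>
      (\<forall>v\<in>vars (bs ! j). \<forall>c. layers_table L' R c v = layers_table L R c v)"
      using restrict_layers[OF R, of "{bs ! k}" L "bs ! j"] L j bs(1) by (auto simp: hit_def)
    then obtain L' where L': "stable_layers \<B> {bs ! j} L'" "layers_consistent L' R"
      "\<And>v c. v \<in> vars (bs ! j) \<Longrightarrow> layers_table L' R c v = layers_table L R c v"
      by blast
    have "layers_table L' R 0 \<in> outcomes (bs ! j) \<and> layers_table L' R 1 i \<in> D"
      using agree[OF j layers_table_in_space[OF R] L'(3) C] L unfolding hit_def by blast
    with L' have "hit (bs ! j) L'" by (simp add: hit_def)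
    with that k have "k \<le> j" unfolding k_def by (intro Least_le) auto
    with that show False by simp
  qed
  moreover have "layers_table L R 1 \<in> space \<Omega>"
    using layers_table_in_space[OF R] unfolding space_S by blast
  ultimately have "R \<in> witness_event bs {x \<in> space \<Omega>. x i \<in> D} (length L)"
    using k L R unfolding witness_event_def first_event_def hit_def layers_upto_def by blast
  then show ?thesis ..
qed

lemma first_event_sets:
  assumes "set bs \<subseteq> \<B>" "k < length bs"
  shows "first_event bs k \<in> sets \<Omega>"
  unfolding first_event_def using assms nth_mem
  by (intro sets.Diff sets.finite_UN outcomes_sets) (auto simp: subset_iff)

lemma witness_event_sets:
  assumes "set bs \<subseteq> \<B>" and "F \<in> sets \<Omega>"
  shows "witness_event bs F h \<in> sets S"
  unfolding witness_event_def
proof (intro sets.finite_UN)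
  fix k L assume k: "k \<in> {..<length bs}" and L: "L \<in> layers_upto h {bs ! k}"
  show "{R \<in> space S. layers_consistent L R \<and> layers_table L R 0 \<in> first_event bs k \<and> layers_table L R 1 \<in> F} \<in> sets S"
  proof (rule layers_event_sets)
    show "I \<subseteq> \<B>" if "I \<in> set L" for I
      using that L stable_layers_subset unfolding layers_upto_def by blast
    show "first_event bs k \<in> sets \<Omega>" using assms(1) k by (intro first_event_sets) auto
  qed (rule assms(2))
qed (simp_all add: finite_layers_upto)

text \<open>A union bound over events and layers, whose terms factor by
  \<open>emeasure_layers_event\<close>. For every \<open>k\<close> the sum over layers is at most
  the exponential, and the probabilities of the disjoint first events add up to that of their
  union.\<close>

lemma emeasure_witness_event:
  assumes p: "\<And>B. B \<in> \<B> \<Longrightarrow> measure \<Omega> (outcomes B) \<le> p"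
    and d: "\<And>B. B \<in> \<B> \<Longrightarrow> real (card (nbhd \<B> B)) \<le> d"
    and epd: "exp 1 * p * d \<le> 1"
    and bs: "set bs \<subseteq> \<B>" and F: "F \<in> sets \<Omega>"
  shows "emeasure S (witness_event bs F h)
    \<le> ennreal (exp (exp 1 * p * d) * measure \<Omega> (\<Union>B\<in>set bs. outcomes B) * measure \<Omega> F)"
proof -
  let ?x = "exp (exp 1 * p * d)"
  let ?W = "\<lambda>k L. {R \<in> space S. layers_consistent L R \<and> layers_table L R 0 \<in> first_event bs k \<and> layers_table L R 1 \<in> F}"
  have E: "first_event bs k \<in> sets \<Omega>" if "k < length bs" for k
    using that bs by (intro first_event_sets)
  have L: "I \<subseteq> \<B> \<and> stable I" if "L \<in> layers_upto h P" "I \<in> set L" for L P I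
    using that stable_layers_subset unfolding layers_upto_def by blast
  have W: "emeasure S (?W k L) = ennreal (weight L * measure \<Omega> (first_event bs k) * measure \<Omega> F)"
    if "k < length bs" "L \<in> layers_upto h {bs ! k}" for k L
    by (intro emeasure_layers_event E that F) (use L[OF that(2)] in blast)
  have sets: "?W k L \<in> sets S" if "k < length bs" "L \<in> layers_upto h {bs ! k}" for k L
    by (intro layers_event_sets E that F) (use L[OF that(2)] in blast)
  have sum_le: "(\<Sum>L\<in>layers_upto h {bs ! k}. weight L) \<le> ?x" if "k < length bs" for k
  proof -
    have B: "bs ! k \<in> \<B>" using that bs nth_mem by blast
    have "0 \<le> p" using p[OF B] measure_nonneg order_trans by blast
    from sum_weight_le[OF p this d epd, of "{bs ! k}"] B show ?thesis by simp
  qed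
  have disj: "disjoint_family_on (first_event bs) {..<length bs}"
    unfolding disjoint_family_on_def
  proof (intro ballI impI)
    fix j k :: nat assume "j \<noteq> k"
    then show "first_event bs j \<inter> first_event bs k = {}"
      by (cases "j < k") (auto simp: first_event_def)
  qed
  have "emeasure S (witness_event bs F h) \<le> (\<Sum>k<length bs. emeasure S (\<Union>L\<in>layers_upto h {bs ! k}. ?W k L))"
    unfolding witness_event_def
    by (intro emeasure_subadditive_finite image_subsetI sets.finite_UN sets finite_layers_upto) simp_all
  also have "\<dots> \<le> (\<Sum>k<length bs. \<Sum>L\<in>layers_upto h {bs ! k}. emeasure S (?W k L))"
    by (intro sum_mono emeasure_subadditive_finite image_subsetI sets finite_layers_upto) simp_all
  also have "\<dots> = (\<Sum>k<length bs. \<Sum>L\<in>layers_upto h {bs ! k}. ennreal (weight L * measure \<Omega> (first_event bs k) * measure \<Omega> F))"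
    using W by (intro sum.cong refl) auto
  also have "\<dots> = ennreal (\<Sum>k<length bs. \<Sum>L\<in>layers_upto h {bs ! k}. weight L * measure \<Omega> (first_event bs k) * measure \<Omega> F)"
    by (simp add: sum_ennreal weight_nonneg sum_nonneg)
  also have "\<dots> \<le> ennreal (?x * measure \<Omega> (\<Union>B\<in>set bs. outcomes B) * measure \<Omega> F)"
  proof (rule ennreal_leI)
    have "(\<Sum>k<length bs. \<Sum>L\<in>layers_upto h {bs ! k}. weight L * measure \<Omega> (first_event bs k) * measure \<Omega> F)
      = (\<Sum>k<length bs. (\<Sum>L\<in>layers_upto h {bs ! k}. weight L) * measure \<Omega> (first_event bs k)) * measure \<Omega> F"
      by (simp add: sum_distrib_right)
    also have "\<dots> \<le> (\<Sum>k<length bs. ?x * measure \<Omega> (first_event bs k)) * measure \<Omega> F"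
      by (intro mult_right_mono sum_mono sum_le) simp_all
    also have "(\<Sum>k<length bs. ?x * measure \<Omega> (first_event bs k)) = ?x * measure \<Omega> (\<Union>k<length bs. first_event bs k)"
      unfolding sum_distrib_left[symmetric]
      using E disj by (subst M.finite_measure_finite_Union) auto
    also have "?x * measure \<Omega> (\<Union>k<length bs. first_event bs k) * measure \<Omega> F
      \<le> ?x * measure \<Omega> (\<Union>B\<in>set bs. outcomes B) * measure \<Omega> F"
    proof (intro mult_right_mono mult_left_mono M.finite_measure_mono)
      show "(\<Union>k<length bs. first_event bs k) \<subseteq> (\<Union>B\<in>set bs. outcomes B)"
        by (auto simp: first_event_def)
      show "(\<Union>B\<in>set bs. outcomes B) \<in> sets \<Omega>"
        using bs by (intro sets.finite_UN outcomes_sets) auto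
    qed simp_all
    finally show "(\<Sum>k<length bs. \<Sum>L\<in>layers_upto h {bs ! k}. weight L * measure \<Omega> (first_event bs k) * measure \<Omega> F)
      \<le> ?x * measure \<Omega> (\<Union>B\<in>set bs. outcomes B) * measure \<Omega> F" .
  qed
  finally show ?thesis .
qed

text \<open>The bound is uniform in \<open>h\<close>, so it passes to the increasing union by
  continuity from below.\<close>

lemma emeasure_UN_witness_event:
  assumes p: "\<And>B. B \<in> \<B> \<Longrightarrow> measure \<Omega> (outcomes B) \<le> p"
    and d: "\<And>B. B \<in> \<B> \<Longrightarrow> real (card (nbhd \<B> B)) \<le> d"
    and epd: "exp 1 * p * d \<le> 1"
    and bs: "set bs \<subseteq> \<B>" and F: "F \<in> sets \<Omega>"
  shows "emeasure S (\<Union>h. witness_event bs F h)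
    \<le> ennreal (exp (exp 1 * p * d) * measure \<Omega> (\<Union>B\<in>set bs. outcomes B) * measure \<Omega> F)"
proof -
  have "incseq (witness_event bs F)"
  proof (rule incseq_SucI)
    have "layers_upto h P \<subseteq> layers_upto (Suc h) P" for h P by (auto simp: layers_upto_def)
    then show "witness_event bs F h \<subseteq> witness_event bs F (Suc h)" for h
      unfolding witness_event_def by blast
  qed
  then have "emeasure S (\<Union>h. witness_event bs F h) = (SUP h. emeasure S (witness_event bs F h))"
    using witness_event_sets[OF bs F] by (intro SUP_emeasure_incseq[symmetric]) auto
  also have "\<dots> \<le> ennreal (exp (exp 1 * p * d) * measure \<Omega> (\<Union>B\<in>set bs. outcomes B) * measure \<Omega> F)"
    by (intro SUP_least emeasure_witness_event assms)
  finally show ?thesis .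
qed

section \<open>Null sets avoided along all words\<close>

text \<open>Advancing preserves the law of the table, so an almost sure property survives any fixed
  word.\<close>

lemma AE_word_table:
  assumes "AE R in S. P R"
  shows "AE R in S. P (word_table w R)"
proof (induction w)
  case Nil
  then show ?case using assms by simp
next
  case (Cons B w)
  have "AE R in distr S S (advance (vars B)). P (word_table w R)"
    using Cons by (simp only: distr_advance)
  from AE_distrD[OF _ this] show ?case by simp
qed

text \<open>The word of a run depends on the table, so all words are treated at once; over finitely
  many bad-events there are only countably many.\<close>

lemma AE_words_avoid_null_sets:
  assumes "\<And>N. N \<in> \<N> \<Longrightarrow> N \<in> null_sets \<Omega>" "countable \<N>"
  shows "AE R in S. \<forall>w\<in>lists \<B>. \<forall>N\<in>\<N>. word_table w R 0 \<notin> N"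
proof -
  have "AE R in S. word_table w R 0 \<notin> N" if "N \<in> \<N>" for w N
  proof (rule AE_word_table)
    show "AE R in S. R 0 \<notin> N"
      by (rule AE_PiM_component[of UNIV "\<lambda>_. \<Omega>" 0 "\<lambda>x. x \<notin> N"])
        (use prob_space_Omega AE_not_in[OF assms(1)[OF that]] in auto)
  qed
  then show ?thesis
    using assms(2) finite_bad by (simp add: AE_ball_countable countable_lists countable_finite)
qed

end

section \<open>The state at a fixed time\<close>

context resampling_rule
begin

text \<open>Conditioning on the initial state, which is row 0 on both sides, reduces this to
  \<open>nn_integral_sample_run\<close>.\<close>

lemma nn_integral_run:
  assumes "F \<in> borel_measurable (H k)"
  shows "(\<integral>\<^sup>+y. F (sample_run \<tau> k 0 (\<lambda>s\<in>{..0}. y 0) (\<lambda>s. y (Suc s))) \<partial>S)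
    = (\<integral>\<^sup>+R. F (table_run \<tau> k 0 (\<lambda>s\<in>{..0}. R 0) R) \<partial>S)"
proof -
  have F: "F \<in> borel_measurable (H (0 + k))" using assms by simp
  have init: "(\<lambda>R. \<lambda>s\<in>{..0::nat}. R 0) \<in> S \<rightarrow>\<^sub>M H 0"
    by (intro measurable_restrict measurable_level)
  have S: "(\<lambda>R. R) \<in> S \<rightarrow>\<^sub>M S" by simp
  have m1: "(\<lambda>y. F (sample_run \<tau> k 0 (\<lambda>s\<in>{..0}. y 0) (\<lambda>s. y (Suc s)))) \<in> borel_measurable S"
    by (rule measurable_compose[OF measurable_sample_run[OF init measurable_tail] F])
  have m2: "(\<lambda>R. F (table_run \<tau> k 0 (\<lambda>s\<in>{..0}. R 0) R)) \<in> borel_measurable S"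
    by (rule measurable_compose[OF measurable_table_run[OF init S] F])
  have "(\<integral>\<^sup>+y. F (sample_run \<tau> k 0 (\<lambda>s\<in>{..0}. x) y) \<partial>S) = (\<integral>\<^sup>+R. F (table_run \<tau> k 0 (\<lambda>s\<in>{..0}. x) (case_nat x R)) \<partial>S)"
    if "x \<in> space \<Omega>" for x
    using nn_integral_sample_run[of "\<lambda>s\<in>{..0}. x", OF _ F] that by (simp add: space_PiM)
  then show ?thesis
    unfolding nn_integral_S_split[OF m1] nn_integral_S_split[OF m2]
    by (intro nn_integral_cong[of \<Omega>]) (simp only: nat.case)
qed

text \<open>On the table, the state at time \<open>k\<close> lies in \<open>A\<close> only if row 0
  does or if a resampling brings column \<open>i\<close> into \<open>D\<close>; outside a null set,
  the latter is covered by the witness events.\<close>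

lemma emeasure_state_le:
  assumes p: "\<And>B. B \<in> \<B> \<Longrightarrow> measure \<Omega> (outcomes B) \<le> p"
    and d: "\<And>B. B \<in> \<B> \<Longrightarrow> real (card (nbhd \<B> B)) \<le> d"
    and epd: "exp 1 * p * d \<le> 1"
    and i: "i \<in> {1..n}" and D: "D \<in> sets (M i)"
  defines "A \<equiv> {x \<in> space \<Omega>. x i \<in> D}"
  shows "emeasure S {y \<in> space S. sample_run \<tau> k 0 (\<lambda>s\<in>{..0}. y 0) (\<lambda>s. y (Suc s)) k \<in> A}
    \<le> ennreal (measure \<Omega> A * (1 + exp (exp 1 * p * d) *
        measure \<Omega> (\<Union>B\<in>{B \<in> \<B>. measure \<Omega> (outcomes B - A) > 0 \<and> i \<in> vars B}. outcomes B)))"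
    (is "_ \<le> ennreal (_ * (1 + _ * measure \<Omega> (\<Union>B\<in>?B. _)))")
proof -
  let ?run = "\<lambda>R. table_run \<tau> k 0 (\<lambda>s\<in>{..0}. R 0) R"
  have A: "A \<in> sets \<Omega>" unfolding A_def using i D by (rule value_set_measurable)
  have init: "(\<lambda>R. \<lambda>s\<in>{..0::nat}. R 0) \<in> S \<rightarrow>\<^sub>M H 0"
    by (intro measurable_restrict measurable_level)
  have S: "(\<lambda>R. R) \<in> S \<rightarrow>\<^sub>M S" by simp
  have ind: "(\<lambda>h. indicator A (h k)) \<in> borel_measurable (H k)"
    by (rule measurable_compose[OF measurable_component_singleton]) (use A in simp_all)
  have m1: "{y \<in> space S. sample_run \<tau> k 0 (\<lambda>s\<in>{..0}. y 0) (\<lambda>s. y (Suc s)) k \<in> A} \<in> sets S"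
    using pred_sets2[OF A measurable_compose[OF measurable_sample_run[OF init measurable_tail] measurable_component_singleton]]
    by (simp add: pred_def)
  have m2: "{R \<in> space S. ?run R k \<in> A} \<in> sets S"
    using pred_sets2[OF A measurable_compose[OF measurable_table_run[OF init S] measurable_component_singleton]]
    by (simp add: pred_def)
  have "emeasure S {y \<in> space S. sample_run \<tau> k 0 (\<lambda>s\<in>{..0}. y 0) (\<lambda>s. y (Suc s)) k \<in> A}
    = (\<integral>\<^sup>+y. indicator A (sample_run \<tau> k 0 (\<lambda>s\<in>{..0}. y 0) (\<lambda>s. y (Suc s)) k) \<partial>S)"
    by (subst nn_integral_indicator[OF m1, symmetric], intro nn_integral_cong) (simp add: indicator_def)
  also have "\<dots> = (\<integral>\<^sup>+R. indicator A (?run R k) \<partial>S)"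
    by (rule nn_integral_run[OF ind])
  also have "\<dots> = emeasure S {R \<in> space S. ?run R k \<in> A}"
    by (subst nn_integral_indicator[OF m2, symmetric], intro nn_integral_cong) (simp add: indicator_def)
  finally have law: "emeasure S {y \<in> space S. sample_run \<tau> k 0 (\<lambda>s\<in>{..0}. y 0) (\<lambda>s. y (Suc s)) k \<in> A}
    = emeasure S {R \<in> space S. ?run R k \<in> A}" .

  obtain bs where bs: "set bs = ?B"
    using finite_bad finite_list[of ?B] by auto
  then have bs': "set bs \<subseteq> \<B>" "\<And>B. B \<in> set bs \<Longrightarrow> i \<in> vars B" by auto
  let ?W = "\<Union>h. witness_event bs A h"
  have W: "?W \<in> sets S"
    using witness_event_sets[OF bs'(1) A] by (intro sets.countable_UN) auto
  have R0: "{R \<in> space S. R 0 \<in> A} \<in> sets S"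
    using pred_sets2[OF A measurable_level] by (simp add: pred_def)
  \<comment> \<open>For bad-events outside \<open>\<B>[A]\<close> the set
    \<open>outcomes B - A\<close> is null. Avoiding these sets forces the event found in the run
    into \<open>set bs\<close>, since it is true while \<open>A\<close> fails.\<close>
  define \<N> where "\<N> = (\<lambda>B. outcomes B - A) ` {B \<in> \<B>. measure \<Omega> (outcomes B - A) = 0}"
  have "AE R in S. \<forall>w\<in>lists \<B>. \<forall>N\<in>\<N>. word_table w R 0 \<notin> N"
  proof (rule AE_words_avoid_null_sets)
    show "N \<in> null_sets \<Omega>" if "N \<in> \<N>" for N
      using that A outcomes_sets by (auto simp: \<N>_def null_sets_def M.emeasure_eq_measure)
    show "countable \<N>" unfolding \<N>_def using finite_bad by (intro countable_finite) auto
  qed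
  then have "AE R in S. R \<in> {R \<in> space S. ?run R k \<in> A} \<longrightarrow> R \<in> {R \<in> space S. R 0 \<in> A} \<union> ?W"
    using AE_space
  proof eventually_elim
    fix R assume null: "\<forall>w\<in>lists \<B>. \<forall>N\<in>\<N>. word_table w R 0 \<notin> N" and R: "R \<in> space S"
    show "R \<in> {R \<in> space S. ?run R k \<in> A} \<longrightarrow> R \<in> {R \<in> space S. R 0 \<in> A} \<union> ?W"
    proof (intro impI, rule ccontr)
      assume run: "R \<in> {R \<in> space S. ?run R k \<in> A}" and not: "R \<notin> {R \<in> space S. R 0 \<in> A} \<union> ?W"
      have "R 0 \<in> space \<Omega>" using R unfolding space_S by blast
      with not R have "R 0 i \<notin> D" by (simp add: A_def)
      moreover have "(\<lambda>s\<in>{..0::nat}. R 0) \<in> space (H 0)" using measurable_space[OF init R] .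
      ultimately obtain w B where w: "set w \<subseteq> \<B>" "word_consistent w R" "B \<in> \<B>" "i \<in> vars B"
        "word_table w R 0 \<in> outcomes B" "word_table w R 0 i \<notin> D" "word_table w R 1 i \<in> D"
        using table_run_reaches[OF R, of "\<lambda>s\<in>{..0}. R 0" 0 k i D] run by (auto simp: A_def)
      have "word_table w R 0 \<in> outcomes B - A" using w by (simp add: A_def)
      with null w have "measure \<Omega> (outcomes B - A) \<noteq> 0" by (auto simp: \<N>_def)
      then have "measure \<Omega> (outcomes B - A) > 0" using measure_nonneg[of \<Omega> "outcomes B - A"] by linarith
      with w bs have "B \<in> set bs" by simp
      from witness_event_cover[OF R bs' w(1,2) this w(5,7)] not show False by (simp add: A_def)
    qed
  qed
  then have "emeasure S {R \<in> space S. ?run R k \<in> A} \<le> emeasure S ({R \<in> space S. R 0 \<in> A} \<union> ?W)"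
    by (rule emeasure_mono_AE) (use R0 W in simp)
  also have "\<dots> \<le> emeasure S {R \<in> space S. R 0 \<in> A} + emeasure S ?W"
    by (rule emeasure_subadditive[OF R0 W])
  also have "\<dots> \<le> ennreal (measure \<Omega> A) + ennreal (exp (exp 1 * p * d) * measure \<Omega> (\<Union>B\<in>set bs. outcomes B) * measure \<Omega> A)"
  proof (rule add_mono)
    show "emeasure S ?W \<le> ennreal (exp (exp 1 * p * d) * measure \<Omega> (\<Union>B\<in>set bs. outcomes B) * measure \<Omega> A)"
      by (rule emeasure_UN_witness_event[OF p d epd bs'(1) A])
    \<comment> \<open>This is the case of no layers, with no restriction on row 1.\<close>
    have "emeasure S {R \<in> space S. R 0 \<in> A} = ennreal (measure \<Omega> A)"
      using emeasure_layers_event[of "[]" A "space \<Omega>"] A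
      by (simp add: M.prob_space space_S cong: conj_cong)
    then show "emeasure S {R \<in> space S. R 0 \<in> A} \<le> ennreal (measure \<Omega> A)" by simp
  qed
  also have "\<dots> = ennreal (measure \<Omega> A * (1 + exp (exp 1 * p * d) * measure \<Omega> (\<Union>B\<in>?B. outcomes B)))"
    unfolding bs by (subst ennreal_plus[symmetric]) (simp_all add: algebra_simps)
  finally show ?thesis unfolding law .
qed

end

section \<open>The distribution at termination\<close>

text \<open>When no bad-event is true, the value of \<open>\<sigma>\<close> is arbitrary; the dummy
  event that resamples nothing replaces it.\<close>

definition active_rule ::
  "'a event set \<Rightarrow> ('u, 'a) rule \<Rightarrow> 'u \<Rightarrow> nat \<Rightarrow> (nat \<Rightarrow> nat \<Rightarrow> 'a) \<Rightarrow> 'a event" where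
  "active_rule \<B> \<sigma> u t h = (if \<exists>B\<in>\<B>. h t \<in> outcomes B then \<sigma> t u h else Event {} {})"

lemma mt_history_eq_sample_run:
  "mt_history \<B> \<sigma> u y k = sample_run (active_rule \<B> \<sigma> u) k 0 (\<lambda>s\<in>{..0}. y 0) (\<lambda>s. y (Suc s))"
proof (induction k)
  case (Suc k)
  have "(if \<exists>B\<in>\<B>. h k \<in> outcomes B then resample (vars (\<sigma> k u h)) (h k) (y (Suc k)) else h k)
    = resample (vars (active_rule \<B> \<sigma> u k h)) (h k) (y (Suc k))" for h :: "nat \<Rightarrow> nat \<Rightarrow> 'a"
    by (simp add: active_rule_def resample_def)
  then show ?case
    by (simp only: mt_history.simps Let_def sample_run_Suc Suc.IH add_0)
qed simp

lemma mt_state_Suc_terminated: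
  "mt_terminated \<B> \<sigma> u y t \<Longrightarrow> mt_state \<B> \<sigma> u y (Suc t) = mt_state \<B> \<sigma> u y t"
  by (auto simp: mt_terminated_def mt_state_def Let_def)

lemma mt_terminated_Suc: "mt_terminated \<B> \<sigma> u y t \<Longrightarrow> mt_terminated \<B> \<sigma> u y (Suc t)"
  using mt_state_Suc_terminated[of \<B> \<sigma> u y t] unfolding mt_terminated_def by simp

context bad_events
begin

text \<open>With the seed fixed, the selection is a function of the history alone, so the estimates
  apply seed by seed.\<close>

lemma resampling_rule_active_rule:
  assumes \<sigma>: "selection_rule n M \<B> U \<sigma>" and u: "u \<in> space U"
  shows "resampling_rule n M \<B> (active_rule \<B> \<sigma> u)"
proof
  let ?H = "\<lambda>t. PiM {..t :: nat} (\<lambda>_. \<Omega>)"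
  have sel: "\<sigma> t u h \<in> \<B> \<and> h t \<in> outcomes (\<sigma> t u h)"
    if "h \<in> space (?H t)" "\<exists>B\<in>\<B>. h t \<in> outcomes B" for h t
    using \<sigma> u that unfolding selection_rule_def by blast
  show "active_rule \<B> \<sigma> u t h \<in> \<B> \<and> h t \<in> outcomes (active_rule \<B> \<sigma> u t h)"
    if "h \<in> space (?H t)" "\<exists>B\<in>\<B>. h t \<in> outcomes B" for h t
    using sel[OF that] that(2) by (simp add: active_rule_def)
  show "active_rule \<B> \<sigma> u t h = Event {} {}" if "\<forall>B\<in>\<B>. h t \<notin> outcomes B" for h t
    using that by (simp add: active_rule_def)
  show "active_rule \<B> \<sigma> u t \<in> ?H t \<rightarrow>\<^sub>M count_space (insert (Event {} {}) \<B>)" for t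
  proof -
    have "(\<lambda>(u, h). \<sigma> t u h) \<in> U \<Otimes>\<^sub>M ?H t \<rightarrow>\<^sub>M count_space UNIV"
      using \<sigma> unfolding selection_rule_def by blast
    from measurable_compose[OF measurable_Pair1'[OF u] this]
    have \<sigma>u: "(\<lambda>h. \<sigma> t u h) \<in> ?H t \<rightarrow>\<^sub>M count_space UNIV" by simp
    have "Measurable.pred (?H t) (\<lambda>h. h t \<in> outcomes B)" if "B \<in> \<B>" for B
      by (intro pred_outcomes that measurable_component_singleton) simp
    then have "Measurable.pred (?H t) (\<lambda>h. \<exists>B\<in>\<B>. h t \<in> outcomes B)"
      by (rule pred_intros_finite(4)[OF finite_bad])
    then have "(\<lambda>h. active_rule \<B> \<sigma> u t h) \<in> ?H t \<rightarrow>\<^sub>M count_space UNIV"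
      unfolding active_rule_def using \<sigma>u by (intro measurable_If) (simp_all add: pred_def)
    moreover have "active_rule \<B> \<sigma> u t h \<in> insert (Event {} {}) \<B>" if "h \<in> space (?H t)" for h
      using sel[OF that] by (simp add: active_rule_def)
    ultimately show ?thesis
      using finite_bad by (auto simp: measurable_count_space_eq2 intro: measurable_sets)
  qed
qed

text \<open>For each seed, the state at termination is also the state at all later times, so the
  bounds for fixed times pass to the limit; the result is integrated over the seed. Runs that never
  terminate lie outside \<open>Z\<close>.\<close>

lemma mt_prob_value_event_le:
  assumes p: "\<And>B. B \<in> \<B> \<Longrightarrow> measure \<Omega> (outcomes B) \<le> p"
    and d: "\<And>B. B \<in> \<B> \<Longrightarrow> real (card (nbhd \<B> B)) \<le> d"
    and epd: "exp 1 * p * d \<le> 1"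
    and \<sigma>: "selection_rule n M \<B> U \<sigma>"
    and i: "i \<in> {1..n}" and D: "D \<in> sets (M i)"
  defines "A \<equiv> {x \<in> space \<Omega>. x i \<in> D}"
  shows "mt_prob n M \<B> U \<sigma> (value_event n M i D)
    \<le> measure \<Omega> A * (1 + exp (exp 1 * p * d) *
        measure \<Omega> (\<Union>B\<in>{B \<in> \<B>. measure \<Omega> (outcomes B - A) > 0 \<and> i \<in> vars B}. outcomes B))"
    (is "_ \<le> ?c")
proof -
  interpret U: prob_space U using \<sigma> by (simp add: selection_rule_def)
  have "0 \<le> ?c" by simp
  have A: "A \<in> sets \<Omega>" unfolding A_def using i D by (rule value_set_measurable)
  define Z where "Z = {(u, y) \<in> space (mt_space n M U). (\<exists>t. mt_terminated \<B> \<sigma> u y t) \<and>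
    mt_state \<B> \<sigma> u y (LEAST t. mt_terminated \<B> \<sigma> u y t) \<in> A}"
  have mtZ: "mt_prob n M \<B> U \<sigma> (value_event n M i D) = measure (U \<Otimes>\<^sub>M S) Z"
    by (simp only: mt_prob_def mt_space_def value_event_def Z_def A_def event.sel)
  have slice: "emeasure S (Pair u -` Z) \<le> ennreal ?c" if u: "u \<in> space U" for u
  proof -
    interpret resampling_rule n M \<B> "active_rule \<B> \<sigma> u"
      using \<sigma> u by (rule resampling_rule_active_rule)
    \<comment> \<open>\<open>T k\<close> increases with \<open>k\<close> because a terminated state
      no longer changes, and the union of these sets contains the slice of \<open>Z\<close>.\<close>
    define T where "T k = {y \<in> space S. mt_terminated \<B> \<sigma> u y k \<and> mt_state \<B> \<sigma> u y k \<in> A}" for k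
    have state: "(\<lambda>y. mt_state \<B> \<sigma> u y k) \<in> S \<rightarrow>\<^sub>M \<Omega>" for k
    proof -
      have "(\<lambda>y. \<lambda>s\<in>{..0::nat}. y 0) \<in> S \<rightarrow>\<^sub>M H 0"
        by (intro measurable_restrict measurable_level)
      from measurable_history_apply[OF measurable_sample_run[OF this measurable_tail]]
      show ?thesis by (simp only: mt_state_def mt_history_eq_sample_run add_0)
    qed
    have T: "T k \<in> sets S" for k
    proof -
      have "Measurable.pred S (\<lambda>y. \<forall>B\<in>\<B>. mt_state \<B> \<sigma> u y k \<notin> outcomes B)"
        by (intro pred_intros_finite(3)[OF finite_bad] pred_intros_logic(2) pred_outcomes state)
      then have "Measurable.pred S (\<lambda>y. mt_terminated \<B> \<sigma> u y k \<and> mt_state \<B> \<sigma> u y k \<in> A)"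
        unfolding mt_terminated_def by (intro pred_intros_logic(3) pred_sets2[OF A state])
      then show ?thesis by (simp add: pred_def T_def)
    qed
    have "incseq T"
      by (rule incseq_SucI)
        (auto simp: T_def mt_state_Suc_terminated intro: mt_terminated_Suc)
    have le: "emeasure S (T k) \<le> ennreal ?c" for k
    proof -
      have "emeasure S (T k) \<le> emeasure S {y \<in> space S.
          sample_run (active_rule \<B> \<sigma> u) k 0 (\<lambda>s\<in>{..0}. y 0) (\<lambda>s. y (Suc s)) k \<in> A}"
      proof (rule emeasure_mono)
        show "{y \<in> space S. sample_run (active_rule \<B> \<sigma> u) k 0 (\<lambda>s\<in>{..0}. y 0) (\<lambda>s. y (Suc s)) k \<in> A} \<in> sets S"
          using pred_sets2[OF A state[of k]] by (simp only: pred_def mt_state_def mt_history_eq_sample_run)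
      qed (simp only: T_def mt_state_def mt_history_eq_sample_run, blast)
      also have "\<dots> \<le> ennreal ?c"
        unfolding A_def by (rule emeasure_state_le[OF p d epd i D])
      finally show ?thesis .
    qed
    have "Pair u -` Z \<subseteq> (\<Union>k. T k)"
    proof
      fix y assume "y \<in> Pair u -` Z"
      then have "y \<in> space S" and ex: "\<exists>t. mt_terminated \<B> \<sigma> u y t"
        and "mt_state \<B> \<sigma> u y (LEAST t. mt_terminated \<B> \<sigma> u y t) \<in> A"
        unfolding Z_def mt_space_def space_pair_measure by simp_all
      with LeastI_ex[OF ex] have "y \<in> T (LEAST t. mt_terminated \<B> \<sigma> u y t)"
        by (simp add: T_def)
      then show "y \<in> (\<Union>k. T k)" by blast
    qed
    then have "emeasure S (Pair u -` Z) \<le> emeasure S (\<Union>k. T k)"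
      using T by (intro emeasure_mono sets.countable_UN) auto
    also have "\<dots> = (SUP k. emeasure S (T k))"
      using T \<open>incseq T\<close> by (intro SUP_emeasure_incseq[symmetric]) auto
    also have "\<dots> \<le> ennreal ?c" by (intro SUP_least le)
    finally show ?thesis .
  qed
  show ?thesis
  proof (cases "Z \<in> sets (U \<Otimes>\<^sub>M S)")
    \<comment> \<open>\<open>measure\<close> is 0 outside the sigma-algebra, so the bound then
      reduces to \<open>0 \<le> ?c\<close>.\<close>
    case False
    with \<open>0 \<le> ?c\<close> show ?thesis by (simp add: mtZ measure_notin_sets)
  next
    case True
    have "emeasure (U \<Otimes>\<^sub>M S) Z = (\<integral>\<^sup>+u. emeasure S (Pair u -` Z) \<partial>U)"
      by (rule P.emeasure_pair_measure_alt[OF True])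
    also have "\<dots> \<le> (\<integral>\<^sup>+u. ennreal ?c \<partial>U)"
      by (intro nn_integral_mono slice)
    also have "\<dots> = ennreal ?c"
      by (simp add: U.emeasure_space_1)
    finally show ?thesis
      unfolding mtZ using enn2real_leI[OF \<open>0 \<le> ?c\<close>] by (simp only: measure_def[of _ Z])
  qed
qed

end

theorem corollary4p6:
  fixes n :: nat and M :: "nat \<Rightarrow> 'a measure" and \<B> :: "'a event set"
    and U :: "'u measure" and \<sigma> :: "('u, 'a) rule"
    and p d :: real and i :: nat and D :: "'a set"
  assumes "variable_setting n M \<B>"
    and "\<And>B. B \<in> \<B> \<Longrightarrow> measure (Omega n M) (outcomes B) \<le> p"
    and "\<And>B. B \<in> \<B> \<Longrightarrow> real (card (nbhd \<B> B)) \<le> d"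
    and "exp 1 * p * d \<le> 1"
    and "selection_rule n M \<B> U \<sigma>"
    and "i \<in> {1..n}" and "D \<in> sets (M i)"
  defines "A \<equiv> value_event n M i D"
  defines "\<B>' \<equiv> {B \<in> bad_not_implying n M \<B> A. i \<in> vars B}"
  shows "mt_prob n M \<B> U \<sigma> A
    \<le> measure (Omega n M) (outcomes A) *
        (1 + exp (exp 1 * p * d) * measure (Omega n M) (\<Union>B\<in>\<B>'. outcomes B))"
proof -
  interpret bad_events n M \<B>
    using assms(1) unfolding variable_setting_def
    by (intro bad_events.intro independent_variables.intro bad_events_axioms.intro) simp_all
  have A: "outcomes A = {x \<in> space (Omega n M). x i \<in> D}"
    by (simp add: A_def value_event_def)
  have B: "\<B>' = {B \<in> \<B>. measure (Omega n M) (outcomes B - outcomes A) > 0 \<and> i \<in> vars B}"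
    by (auto simp: \<B>'_def bad_not_implying_def)
  show ?thesis
    using mt_prob_value_event_le[OF assms(2-7)] unfolding B A by (simp only: A_def)
qed

end
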